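(* For any mixture $\nu$ and $\beta>0$, if $q\in\mathcal S_\beta$ then $$x_\beta^q(t)=x_\beta(q+(1-q)t),$$ and if moreover $q>0$ then $$\big(\alpha_\infty^q(t),c_\infty^q\big)=\Big(\beta x_\beta(qt),\ \frac\beta q\int_q^1x_\beta(s)ds\Big).$$ Here the first identity is for $t\in[0,1]$ and the identity for $\alpha_\infty^q$ is for $t\in[0,1)$.
   Context: A mixture is a function $\nu(x)=\sum_{p\ge1}\gamma_p^2x^p$ with $\gamma_p\ge0$ decaying exponentially fast in $p$. Positive temperature. Let $D([0,1])$ be the set of non-decreasing right-continuous functions $x:[0,1]\to[0,1]$ with $x(\hat q)=1$ for some $\hat q<1$, and $$\mathcal P_\beta(x,\nu)=\frac12\Big(\beta^2\int_0^1x(q)\nu'(q)dq+\int_0^{\hat q}\frac{dq}{\int_q^1x(s)ds}+\log(1-\hat q)\Big)$$ (independent of the choice of such $\hat q$). The Parisi distribution of $\nu$ at inverse temperature $\beta$, denoted $x_\beta$, is the unique minimizer of $\mathcal P_\beta(\cdot,\nu)$ over $D([0,1])$. With $x=x_\beta$, let $\Phi(t)=\beta^2\nu'(t)-\int_0^t\frac{ds}{(\int_s^1x(r)dr)^2}$, $\phi(s)=\int_0^s\Phi(t)dt$ (so $\phi(1)=-\infty$), and $\mathcal S_\beta=\{s\in[0,1]:\phi(s)=\sup_{t\in[0,1]}\phi(t)\}$. Zero temperature. For non-decreasing, right-continuous, integrable $\alpha:[0,1)\to[0,\infty)$ and $c>0$ let $$\mathcal P_\infty(\alpha,c,\nu)=\frac12\Big(\nu'(1)\Big(\int_0^1\alpha(s)ds+c\Big)-\int_0^1\nu''(q)\Big(\int_0^q\alpha(s)ds\Big)dq+\int_0^1\frac{dq}{\int_q^1\alpha(s)ds+c}\Big).$$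 There is a unique minimizer of $\mathcal P_\infty(\cdot,\cdot,\nu)$ over such pairs $(\alpha,c)$. For $q\in[0,1)$, $x_\beta^q$ denotes the Parisi distribution at inverse temperature $\beta$ of the mixture $\nu_q(t)=\nu((1-q)t+q)-\nu(q)-\nu'(q)(1-q)t$, and, for $q>0$, $(\alpha_\infty^q,c_\infty^q)$ denotes the minimizer of $\mathcal P_\infty(\cdot,\cdot,\hat\nu_q)$ for the mixture $\hat\nu_q(t)=\nu(qt)$. *)

theory Defs
  imports "HOL-Analysis.Analysis"
begin

(* The power series represents nu on a neighbourhood of [-1,1] (exponential decay makes the
   radius of convergence exceed 1), so that the two-sided derivatives of nu at the endpoints
   0 and 1, as computed by deriv, are those of the series.
   The coefficient gamma p with p >= 1 is written g (Suc p). *)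
definition mixture :: "(real \<Rightarrow> real) \<Rightarrow> bool" where
  "mixture \<nu> \<longleftrightarrow>
    (\<exists>g :: nat \<Rightarrow> real.
      (\<forall>p\<ge>1. 0 \<le> g p) \<and>
      (\<exists>C c. 0 < c \<and> (\<forall>p\<ge>1. g p \<le> C * exp (- c * real p))) \<and>
      (\<exists>r>1. \<forall>x. \<bar>x\<bar> < r \<longrightarrow> (\<lambda>p. (g (Suc p))\<^sup>2 * x ^ Suc p) sums \<nu> x))"

(* Functions on [0,1] are represented by extensional functions (value undefined off [0,1]),
   so that a minimizer can be unique as an element of the function type. *)
definition parisi_domain :: "(real \<Rightarrow> real) set" where
  "parisi_domain = {x \<in> {0..1} \<rightarrow>\<^sub>E {0..1}.
     mono_on {0..1} x \<and> (\<forall>t\<in>{0..<1}. continuous (at_right t) x) \<and> (\<exists>h\<in>{0..<1}. x h = 1)}"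

(* The value does not depend on which h in [0,1) with x h = 1 is selected. *)
definition parisi_functional :: "real \<Rightarrow> (real \<Rightarrow> real) \<Rightarrow> (real \<Rightarrow> real) \<Rightarrow> real" where
  "parisi_functional \<beta> x \<nu> =
    (let h = (SOME h. h \<in> {0..<1} \<and> x h = 1) in
     1 / 2 * (\<beta>\<^sup>2 * (LBINT q:{0..1}. x q * deriv \<nu> q)
       + (LBINT q:{0..h}. 1 / (LBINT s:{q..1}. x s))
       + ln (1 - h)))"

definition parisi_distribution :: "real \<Rightarrow> (real \<Rightarrow> real) \<Rightarrow> real \<Rightarrow> real" where
  "parisi_distribution \<beta> \<nu> =
    (THE x. is_arg_min (\<lambda>y. parisi_functional \<beta> y \<nu>) (\<lambda>y. y \<in> parisi_domain) x)"

(* Real-valued for t < 1. The inner integral diverges at t = 1; the value there is irrelevant,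
   since it only enters through the integral of Phi over [0,s]. *)
definition parisi_Phi :: "real \<Rightarrow> (real \<Rightarrow> real) \<Rightarrow> real \<Rightarrow> real" where
  "parisi_Phi \<beta> \<nu> t =
    \<beta>\<^sup>2 * deriv \<nu> t
    - (LBINT s:{0..t}. 1 / (LBINT r:{s..1}. parisi_distribution \<beta> \<nu> r)\<^sup>2)"

(* The integral of Phi over [0,s] as an extended real: integral of the positive part (finite,
   as Phi is bounded above) minus integral of the negative part (infinite exactly for s = 1).
   The map ennreal truncates negative reals to 0. *)
definition parisi_phi :: "real \<Rightarrow> (real \<Rightarrow> real) \<Rightarrow> real \<Rightarrow> ereal" where
  "parisi_phi \<beta> \<nu> s =
    enn2ereal (\<integral>\<^sup>+t\<in>{0..s}. ennreal (parisi_Phi \<beta> \<nu> t) \<partial>lborel)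
    - enn2ereal (\<integral>\<^sup>+t\<in>{0..s}. ennreal (- parisi_Phi \<beta> \<nu> t) \<partial>lborel)"

definition parisi_S :: "real \<Rightarrow> (real \<Rightarrow> real) \<Rightarrow> real set" where
  "parisi_S \<beta> \<nu> = {s \<in> {0..1}. parisi_phi \<beta> \<nu> s = (SUP t\<in>{0..1}. parisi_phi \<beta> \<nu> t)}"

definition zero_temp_domain :: "((real \<Rightarrow> real) \<times> real) set" where
  "zero_temp_domain =
    {\<alpha> \<in> {0..<1} \<rightarrow>\<^sub>E {0..}.
       mono_on {0..<1} \<alpha> \<and> (\<forall>t\<in>{0..<1}. continuous (at_right t) \<alpha>) \<and>
       set_integrable lborel {0..<1} \<alpha>} \<times> {0<..}"

definition zero_temp_functional :: "(real \<Rightarrow> real) \<Rightarrow> real \<Rightarrow> (real \<Rightarrow> real) \<Rightarrow> real" where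
  "zero_temp_functional \<alpha> c \<nu> =
    1 / 2 * (deriv \<nu> 1 * ((LBINT s:{0..<1}. \<alpha> s) + c)
      - (LBINT q:{0..<1}. deriv (deriv \<nu>) q * (LBINT s:{0..<q}. \<alpha> s))
      + (LBINT q:{0..<1}. 1 / ((LBINT s:{q..<1}. \<alpha> s) + c)))"

definition zero_temp_minimizer :: "(real \<Rightarrow> real) \<Rightarrow> (real \<Rightarrow> real) \<times> real" where
  "zero_temp_minimizer \<nu> =
    (THE z. is_arg_min (\<lambda>(\<alpha>, c). zero_temp_functional \<alpha> c \<nu>) (\<lambda>z. z \<in> zero_temp_domain) z)"

definition right_mixture :: "(real \<Rightarrow> real) \<Rightarrow> real \<Rightarrow> real \<Rightarrow> real" where
  "right_mixture \<nu> q t = \<nu> ((1 - q) * t + q) - \<nu> q - deriv \<nu> q * (1 - q) * t"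

definition left_mixture :: "(real \<Rightarrow> real) \<Rightarrow> real \<Rightarrow> real \<Rightarrow> real" where
  "left_mixture \<nu> q t = \<nu> (q * t)"

end

theory Submission
  imports Defs "HOL-Probability.Helly_Selection"
begin

text \<open>
  With \<open>X q = \<integral>\<^sub>q\<^sup>1 x\<close> and likewise \<open>Y\<close> for \<open>y\<close>, the identity
  \<open>1/Y = 1/X - (Y - X)/X\<^sup>2 + (Y - X)\<^sup>2/(X\<^sup>2 Y)\<close> shows that twice the Parisi functional changes from
  \<open>x\<close> to \<open>y\<close> by \<open>\<integral>\<Phi> (y - x)\<close> plus a nonnegative remainder that vanishes only for \<open>y = x\<close>. Hence
  \<open>x\<close> is the unique minimizer iff \<open>\<integral>\<Phi> (y - x) \<ge> 0\<close> for all competitors \<open>y\<close>. The same holds at zero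
  temperature, up to a boundary term that vanishes when the first variation is zero at the end point.

  A minimizer exists: \<open>X q \<le> 1 - q\<close> forces \<open>\<Phi>\<close> to be negative near 1 uniformly in \<open>x\<close>, so replacing
  a competitor by 1 there does not increase the energy, and the competitors that are 1 beyond a fixed
  point form a compact set by Helly's selection theorem.

  Let \<open>q\<close> maximize \<open>\<phi>\<close>. Then \<open>\<Phi> q = 0\<close> and \<open>\<integral>\<^sub>s\<^sup>q \<Phi> \<ge> 0\<close> for \<open>s \<le> q\<close>, so
  \<open>\<integral>\<^sub>0\<^sup>q \<Phi> a \<ge> 0\<close> for every nonnegative nondecreasing \<open>a\<close> by the second mean value theorem. Testing
  minimality with competitors that vanish on \<open>[0, q)\<close> gives \<open>\<integral>\<^sub>0\<^sup>q \<Phi> x = 0\<close> and the optimality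
  inequality on \<open>[q, 1]\<close>. Up to affine rescaling and constant factors, \<open>\<Phi>\<close> on \<open>[q, 1]\<close> and on
  \<open>[0, q]\<close> is the first variation of the two restricted problems at the claimed minimizers.
\<close>

section \<open>Integrals over intervals\<close>

lemma set_borel_measurable_mono_on:
  fixes f :: "real \<Rightarrow> real"
  assumes "mono_on A f" "A \<in> sets borel"
  shows "set_borel_measurable lborel A f"
  using borel_measurable_mono_on_fnc[OF assms(1)] assms(2)
  by (simp add: set_borel_measurable_def borel_measurable_restrict_space_iff)

lemma set_integrable_bounded:
  fixes f :: "real \<Rightarrow> real"
  assumes "set_borel_measurable lborel {a..b} f" "\<And>x. x \<in> {a..b} \<Longrightarrow> \<bar>f x\<bar> \<le> B"
  shows "set_integrable lborel {a..b} f"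
proof (rule set_integrable_bound[OF _ assms(1)])
  show "set_integrable lborel {a..b} (\<lambda>_. B)"
    by (intro borel_integrable_atLeastAtMost') auto
  show "AE x in lborel. x \<in> {a..b} \<longrightarrow> norm (f x) \<le> norm B"
    using assms(2) by (intro AE_I2) fastforce
qed

lemma set_integrable_mono_on:
  fixes f :: "real \<Rightarrow> real"
  assumes "mono_on {a..b} f"
  shows "set_integrable lborel {a..b} f"
proof (rule set_integrable_bounded)
  show "set_borel_measurable lborel {a..b} f"
    using assms by (intro set_borel_measurable_mono_on) auto
  show "\<bar>f x\<bar> \<le> \<bar>f a\<bar> + \<bar>f b\<bar>" if "x \<in> {a..b}" for x
    using mono_onD[OF assms, of a x] mono_onD[OF assms, of x b] that by auto
qed

lemma set_integrable_mult_bounded: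
  fixes f g :: "real \<Rightarrow> real"
  assumes "set_integrable lborel A f" "set_borel_measurable lborel A g"
    and "\<And>x. x \<in> A \<Longrightarrow> \<bar>g x\<bar> \<le> B"
  shows "set_integrable lborel A (\<lambda>x. f x * g x)"
proof (rule set_integrable_bound)
  show "set_integrable lborel A (\<lambda>x. B * f x)" using assms(1) by simp
  have "(\<lambda>x. (indicat_real A x *\<^sub>R f x) * (indicat_real A x *\<^sub>R g x)) \<in> borel_measurable lborel"
    using assms(1,2) unfolding set_integrable_def set_borel_measurable_def
    by (intro borel_measurable_times) (auto dest: borel_measurable_integrable)
  then show "set_borel_measurable lborel A (\<lambda>x. f x * g x)"
    unfolding set_borel_measurable_def
    by (rule measurable_cong[THEN iffD1, rotated]) (auto simp: indicator_def)
  have "\<bar>f x\<bar> * \<bar>g x\<bar> \<le> \<bar>B\<bar> * \<bar>f x\<bar>" if "x \<in> A" for x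
    using mult_right_mono[OF assms(3)[OF that], of "\<bar>f x\<bar>"]
      mult_right_mono[OF abs_ge_self[of B], of "\<bar>f x\<bar>"] by (simp add: mult.commute)
  then show "AE x in lborel. x \<in> A \<longrightarrow> norm (f x * g x) \<le> norm (B * f x)"
    by (intro AE_I2) (auto simp: abs_mult)
qed

lemma set_integrable_mult_continuous_on:
  fixes f g :: "real \<Rightarrow> real"
  assumes "set_integrable lborel {a..b} f" "continuous_on {a..b} g"
  shows "set_integrable lborel {a..b} (\<lambda>x. f x * g x)"
proof -
  have "bounded (g ` {a..b})"
    using assms(2) by (intro compact_imp_bounded compact_continuous_image) auto
  then obtain B where "\<And>x. x \<in> {a..b} \<Longrightarrow> \<bar>g x\<bar> \<le> B"
    unfolding bounded_real by blast
  then show ?thesis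
    using assms set_measurable_continuous_on[of "{a..b}" g]
    by (intro set_integrable_mult_bounded) (auto simp: set_borel_measurable_def)
qed

lemma set_integral_split:
  fixes f :: "real \<Rightarrow> real"
  assumes "set_integrable lborel {a..b} f" "a \<le> c" "c \<le> b"
  shows "(LBINT s:{a..b}. f s) = (LBINT s:{a..c}. f s) + (LBINT s:{c..b}. f s)"
proof -
  have 1: "set_integrable lborel {a..c} f" "set_integrable lborel {c..b} f"
    using assms by (auto intro: set_integrable_subset)
  show ?thesis
    using Henstock_Kurzweil_Integration.integral_combine[OF assms(2,3), of f]
      set_borel_integral_eq_integral[OF assms(1)]
      set_borel_integral_eq_integral[OF 1(1)] set_borel_integral_eq_integral[OF 1(2)] by simp
qed

lemma continuous_on_lower_integral:
  fixes f :: "real \<Rightarrow> real"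
  assumes "set_integrable lborel {a..b} f"
  shows "continuous_on {a..b} (\<lambda>q. LBINT s:{a..q}. f s)"
proof -
  have "continuous_on {a..b} (\<lambda>q. integral {a..q} f)"
    using set_borel_integral_eq_integral(1)[OF assms] by (rule indefinite_integral_continuous_1)
  moreover have "(LBINT s:{a..q}. f s) = integral {a..q} f" if "q \<in> {a..b}" for q
    using that by (intro set_borel_integral_eq_integral(2) set_integrable_subset[OF assms]) auto
  ultimately show ?thesis using continuous_on_cong by (metis (no_types, lifting))
qed

lemma continuous_on_upper_integral:
  fixes f :: "real \<Rightarrow> real"
  assumes "set_integrable lborel {a..b} f"
  shows "continuous_on {a..b} (\<lambda>q. LBINT s:{q..b}. f s)"
proof -
  have "(LBINT s:{q..b}. f s) = (LBINT s:{a..b}. f s) - (LBINT s:{a..q}. f s)"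
    if "q \<in> {a..b}" for q
    using set_integral_split[OF assms, of q] that by auto
  moreover have "continuous_on {a..b} (\<lambda>q. (LBINT s:{a..b}. f s) - (LBINT s:{a..q}. f s))"
    by (intro continuous_intros continuous_on_lower_integral assms)
  ultimately show ?thesis using continuous_on_cong by (metis (no_types, lifting))
qed

text \<open>Single points are null sets. The zero temperature functional integrates over half-open
  intervals, and this moves everything to closed ones; read with \<open>a = b\<close> it also shows
  that integrals over a point vanish.\<close>

lemma set_integral_half_open:
  fixes f :: "real \<Rightarrow> real"
  shows "(LBINT s:{a..<b}. f s) = (LBINT s:{a..b}. f s)"
  by (rule set_integral_discrete_difference[where X="{b}"]) auto

lemma set_integrable_half_open:
  fixes f :: "real \<Rightarrow> real"
  shows "set_integrable lborel {a..<b} f \<longleftrightarrow> set_integrable lborel {a..b} f"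
  by (rule set_integrable_discrete_difference[where X="{b}"]) auto

lemma set_integral_affine:
  fixes f :: "real \<Rightarrow> real"
  assumes "c > 0"
  shows "(LBINT s:{t + c * a..t + c * b}. f s) = c * (LBINT s:{a..b}. f (t + c * s))"
  unfolding set_lebesgue_integral_def
  using assms by (subst lborel_integral_real_affine[where c=c and t=t])
    (auto intro!: Bochner_Integration.integral_cong split: split_indicator)

lemma set_integrable_affine:
  fixes f :: "real \<Rightarrow> real"
  assumes "c > 0" "set_integrable lborel {t + c * a..t + c * b} f"
  shows "set_integrable lborel {a..b} (\<lambda>s. f (t + c * s))"
proof -
  have "integrable lborel (\<lambda>s. indicator {t + c * a..t + c * b} (t + c * s) *\<^sub>R f (t + c * s))"
    using assms lborel_integrable_real_affine[of _ c t] unfolding set_integrable_def by auto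
  moreover have "indicat_real {t + c * a..t + c * b} (t + c * s) = indicat_real {a..b} s" for s
    using \<open>c > 0\<close> by (auto simp: indicator_def)
  ultimately show ?thesis by (simp add: set_integrable_def)
qed

text \<open>Fubini for the product of \<open>g q\<close> and \<open>f s\<close> on the triangle
  where q \<le> s. It turns a perturbation of a tail integral into a weight on the perturbation
  itself, and it serves as integration by parts at zero temperature.\<close>

lemma set_integral_triangle:
  fixes f g :: "real \<Rightarrow> real"
  assumes f: "set_integrable lborel {a..b} f" and g: "set_integrable lborel {a..b} g"
  shows "(LBINT q:{a..b}. g q * (LBINT s:{q..b}. f s)) =
    (LBINT s:{a..b}. f s * (LBINT q:{a..s}. g q))"
proof -
  define F where "F s = indicat_real {a..b} s * f s" for s
  define G where "G s = indicat_real {a..b} s * g s" for s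
  have F[measurable]: "integrable lborel F" and G[measurable]: "integrable lborel G"
    using f g by (simp_all add: F_def[abs_def] G_def[abs_def] set_integrable_def)
  have [measurable]: "F \<in> borel_measurable borel" "G \<in> borel_measurable borel"
    using F G by (auto dest: borel_measurable_integrable)
  \<comment> \<open>\<open>H\<close> is the integrand cut to the triangle; it is dominated by the
    product \<open>G q * F s\<close>, hence integrable on the plane.\<close>
  define H where "H q s = (if q \<le> s then G q * F s else 0)" for q s
  have Hm[measurable]: "case_prod H \<in> borel_measurable (lborel \<Otimes>\<^sub>M lborel)"
    unfolding H_def by measurable
  have "integrable (lborel \<Otimes>\<^sub>M lborel) (\<lambda>(q, s). G q * F s)"
  proof (rule lborel_pair.Fubini_integrable)
    show "integrable lborel (\<lambda>x. LBINT y. norm (case (x, y) of (q, s) \<Rightarrow> G q * F s))"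
      using G by (simp add: abs_mult)
  qed (use F in auto)
  then have H: "integrable (lborel \<Otimes>\<^sub>M lborel) (case_prod H)"
    by (rule Bochner_Integration.integrable_bound) (auto simp: H_def)
  have "(LBINT q:{a..b}. g q * (LBINT s:{q..b}. f s)) = (LBINT q. LBINT s. H q s)"
    unfolding set_lebesgue_integral_def
  proof (intro Bochner_Integration.integral_cong refl)
    fix q
    have "(LBINT s. H q s) = (LBINT s. G q * (indicator {q..b} s *\<^sub>R f s))"
      by (intro Bochner_Integration.integral_cong) (auto simp: H_def G_def F_def indicator_def)
    then show "indicat_real {a..b} q *\<^sub>R (g q * (LBINT s. indicat_real {q..b} s *\<^sub>R f s)) =
        (LBINT s. H q s)"
      by (simp add: G_def)
  qed
  also have "\<dots> = (LBINT s. LBINT q. H q s)"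
    using lborel_pair.Fubini_integral[OF H] by simp
  also have "\<dots> = (LBINT s:{a..b}. f s * (LBINT q:{a..s}. g q))"
    unfolding set_lebesgue_integral_def
  proof (intro Bochner_Integration.integral_cong refl)
    fix s
    have "(LBINT q. H q s) = (LBINT q. F s * (indicator {a..s} q *\<^sub>R g q))"
      by (intro Bochner_Integration.integral_cong) (auto simp: H_def G_def F_def indicator_def)
    then show "(LBINT q. H q s) = indicat_real {a..b} s *\<^sub>R (f s * (LBINT q. indicat_real {a..s} q *\<^sub>R g q))"
      by (simp add: F_def)
  qed
  finally show ?thesis .
qed

text \<open>By right continuity the indefinite integral of \<open>f\<close> from \<open>t\<close>
  has right derivative \<open>f t\<close> at \<open>t\<close>, and it vanishes identically. This
  upgrades equality of tail integrals to equality at every point of [a, b), not only almost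
  everywhere.\<close>

lemma eq_0_if_upper_integrals_eq_0:
  fixes f :: "real \<Rightarrow> real"
  assumes f: "set_integrable lborel {a..b} f" and t: "t \<in> {a..<b}"
    and cont: "continuous (at_right t) f"
    and zero: "\<And>q. q \<in> {a..b} \<Longrightarrow> (LBINT s:{q..b}. f s) = 0"
  shows "f t = 0"
proof -
  have int: "set_integrable lborel {t..u} f" if "u \<in> {t..b}" for u
    using f t that by (auto intro: set_integrable_subset)
  have 0: "integral {t..u} f = 0" if "u \<in> {t..b}" for u
    using set_integral_split[OF int[of b], of u] zero[of t] zero[of u] t that
      set_borel_integral_eq_integral(2)[OF int[OF that]] by auto
  have "((\<lambda>u. integral {t..u} f) has_vector_derivative f t) (at t within {t..b} - {})"
  proof (rule integral_has_vector_derivative_continuous_at)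
    show "f integrable_on {t..b}"
      using set_borel_integral_eq_integral(1)[OF int[of b]] t by auto
    show "continuous (at t within {t..b} - {}) f"
      using cont t at_within_Icc_at_right[of t b] by simp
  qed (use t in auto)
  moreover have "((\<lambda>u. integral {t..u} f) has_vector_derivative 0) (at t within {t..b})"
    by (rule has_vector_derivative_transform[OF _ _ has_vector_derivative_const[of 0]])
      (use t 0 in auto)
  ultimately show ?thesis
    using t by (intro vector_derivative_unique_within[of t "{t..b}"])
      (auto simp: at_within_Icc_at_right trivial_limit_at_right_real)
qed

text \<open>The second mean value theorem gives a point c such that the integral is g(a) times the
  integral of f over [a, c] plus g(b) times that over [c, b]. Regrouped as g(a) times the full
  integral plus g(b) - g(a) times the integral over [c, b], it has only nonnegative factors.\<close>

lemma set_integral_mult_mono_on_nonneg: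
  fixes f g :: "real \<Rightarrow> real"
  assumes f: "set_integrable lborel {a..b} f" and ab: "a \<le> b"
    and pos: "\<And>s. s \<in> {a..b} \<Longrightarrow> 0 \<le> (LBINT t:{s..b}. f t)"
    and g: "mono_on {a..b} g" "0 \<le> g a"
  shows "0 \<le> (LBINT t:{a..b}. f t * g t)"
proof -
  have fi: "set_integrable lborel {c..d} f" if "a \<le> c" "d \<le> b" for c d
    using f that by (auto intro: set_integrable_subset)
  have eq: "integral {c..d} f = (LBINT t:{c..d}. f t)" if "a \<le> c" "d \<le> b" for c d
    using set_borel_integral_eq_integral(2)[OF fi[OF that]] by simp
  obtain c where c: "c \<in> {a..b}"
    "integral {a..b} (\<lambda>x. g x * f x) = g a * integral {a..c} f + g b * integral {c..b} f"
    using second_mean_value_theorem[of f a b g] set_borel_integral_eq_integral(1)[OF f] ab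
      mono_onD[OF g(1)] by auto
  have "set_integrable lborel {a..b} (\<lambda>t. f t * g t)"
  proof (rule set_integrable_mult_bounded[OF f])
    show "set_borel_measurable lborel {a..b} g"
      using g by (intro set_borel_measurable_mono_on) auto
    show "\<bar>g x\<bar> \<le> g b" if "x \<in> {a..b}" for x
      using mono_onD[OF g(1), of a x] mono_onD[OF g(1), of x b] that g(2) by auto
  qed
  then have "(LBINT t:{a..b}. f t * g t) = g a * integral {a..c} f + g b * integral {c..b} f"
    using c by (simp add: set_borel_integral_eq_integral(2) mult.commute)
  also have "\<dots> = g a * (LBINT t:{a..b}. f t) + (g b - g a) * (LBINT t:{c..b}. f t)"
    using c set_integral_split[OF f, of c] by (simp add: eq algebra_simps)
  also have "\<dots> \<ge> 0"
    using pos[of a] pos[of c] c ab g mono_onD[OF g(1), of a b] by (intro add_nonneg_nonneg mult_nonneg_nonneg) auto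
  finally show ?thesis .
qed

section \<open>The Parisi functional and its first variation\<close>

definition tail_mass :: "(real \<Rightarrow> real) \<Rightarrow> real \<Rightarrow> real" where
  "tail_mass x q = (LBINT s:{q..1}. x s)"

text \<open>The density of the derivative of the energy. \<open>w\<close> and \<open>X\<close> are
  parameters so that one definition serves positive temperature, with \<open>X\<close> a tail mass,
  and zero temperature, with \<open>X\<close> a tail integral plus a positive constant.\<close>

definition first_variation :: "(real \<Rightarrow> real) \<Rightarrow> (real \<Rightarrow> real) \<Rightarrow> real \<Rightarrow> real" where
  "first_variation w X t = w t - (LBINT s:{0..t}. 1 / (X s)\<^sup>2)"

text \<open>Twice the Parisi functional when \<open>w q = \<beta>\<^sup>2 * deriv \<nu> q\<close>.
  The cutoff \<open>h\<close> is explicit, so that two functions can be compared at a common cutoff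
  instead of the ones picked by Hilbert choice.\<close>

definition energy :: "(real \<Rightarrow> real) \<Rightarrow> real \<Rightarrow> (real \<Rightarrow> real) \<Rightarrow> real" where
  "energy w h x = (LBINT q:{0..1}. x q * w q) + (LBINT q:{0..h}. 1 / tail_mass x q) + ln (1 - h)"

text \<open>The identity for \<open>1 / Y q\<close> is an exact second order Taylor formula; after
  integration its linear term becomes a weight on \<open>d\<close> by
  \<open>set_integral_triangle\<close>. The constant \<open>e\<close> is 0 at positive temperature
  and is the change of the additive constant at zero temperature.\<close>

lemma integral_inverse_expansion:
  fixes d X Y :: "real \<Rightarrow> real"
  assumes d: "set_integrable lborel {a..b} d" and X: "continuous_on {a..b} X"
    and pos: "\<And>q. q \<in> {a..b} \<Longrightarrow> 0 < X q" "\<And>q. q \<in> {a..b} \<Longrightarrow> 0 < Y q"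
    and Y: "\<And>q. q \<in> {a..b} \<Longrightarrow> Y q = X q + (LBINT s:{q..b}. d s) + e"
  shows "(LBINT q:{a..b}. 1 / Y q) = (LBINT q:{a..b}. 1 / X q)
    - (LBINT s:{a..b}. d s * (LBINT q:{a..s}. 1 / (X q)\<^sup>2)) - e * (LBINT q:{a..b}. 1 / (X q)\<^sup>2)
    + (LBINT q:{a..b}. (Y q - X q)\<^sup>2 / ((X q)\<^sup>2 * Y q))"
    (is "?L = ?R")
    and "continuous_on {a..b} Y"
proof -
  define T where "T q = (LBINT s:{q..b}. d s)" for q
  have T: "continuous_on {a..b} T"
    unfolding T_def by (rule continuous_on_upper_integral[OF d])
  have "continuous_on {a..b} (\<lambda>q. X q + T q + e)"
    by (intro continuous_intros X T)
  then show Yc: "continuous_on {a..b} Y"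
    using Y by (subst continuous_on_cong[OF refl]) (auto simp: T_def)
  have ne: "X q \<noteq> 0" "Y q \<noteq> 0" if "q \<in> {a..b}" for q
    using pos[OF that] by auto
  let ?I = "\<lambda>f. set_integrable lborel {a..b} f"
  have 1: "?I (\<lambda>q. 1 / X q)" and 2: "?I (\<lambda>q. 1 / (X q)\<^sup>2)" and 3: "?I (\<lambda>q. 1 / (X q)\<^sup>2 * T q)"
    and 4: "?I (\<lambda>q. (Y q - X q)\<^sup>2 / ((X q)\<^sup>2 * Y q))"
    using ne by (auto intro!: borel_integrable_atLeastAtMost' continuous_intros X T Yc)
  have lin: "(LBINT q:{a..b}. f1 q - f2 q - e * f3 q + f4 q) = (LBINT q:{a..b}. f1 q)
      - (LBINT q:{a..b}. f2 q) - (LBINT q:{a..b}. e * f3 q) + (LBINT q:{a..b}. f4 q)"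
    if "?I f1" "?I f2" "?I f3" "?I f4" for f1 f2 f3 f4 :: "real \<Rightarrow> real"
    using that by simp
  have "?L = (LBINT q:{a..b}. 1 / X q - 1 / (X q)\<^sup>2 * T q - e * (1 / (X q)\<^sup>2)
      + (Y q - X q)\<^sup>2 / ((X q)\<^sup>2 * Y q))"
  proof (intro set_lebesgue_integral_cong allI impI)
    fix q assume q: "q \<in> {a..b}"
    have "1 / Y q = 1 / X q - 1 / (X q)\<^sup>2 * (Y q - X q) + (Y q - X q)\<^sup>2 / ((X q)\<^sup>2 * Y q)"
      using ne[OF q] by (simp add: field_simps power2_eq_square)
    moreover have "Y q - X q = T q + e"
      using Y[OF q] by (simp add: T_def)
    then have "1 / (X q)\<^sup>2 * (Y q - X q) = 1 / (X q)\<^sup>2 * T q + e * (1 / (X q)\<^sup>2)"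
      by (simp add: distrib_left)
    ultimately show "1 / Y q = 1 / X q - 1 / (X q)\<^sup>2 * T q - e * (1 / (X q)\<^sup>2)
        + (Y q - X q)\<^sup>2 / ((X q)\<^sup>2 * Y q)"
      by linarith
  qed simp
  also have "\<dots> = (LBINT q:{a..b}. 1 / X q) - (LBINT q:{a..b}. 1 / (X q)\<^sup>2 * T q)
      - (LBINT q:{a..b}. e * (1 / (X q)\<^sup>2)) + (LBINT q:{a..b}. (Y q - X q)\<^sup>2 / ((X q)\<^sup>2 * Y q))"
    by (rule lin) (use 1 2 3 4 in auto)
  also have "(LBINT q:{a..b}. 1 / (X q)\<^sup>2 * T q) =
      (LBINT s:{a..b}. d s * (LBINT q:{a..s}. 1 / (X q)\<^sup>2))"
    unfolding T_def by (rule set_integral_triangle[OF d 2])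
  finally show "?L = ?R" by (simp only: set_integral_mult_right)
qed

lemma integral_square_remainder_nonneg:
  fixes X Y :: "real \<Rightarrow> real"
  assumes "\<And>q. q \<in> {a..b} \<Longrightarrow> 0 < Y q"
  shows "0 \<le> (LBINT q:{a..b}. (Y q - X q)\<^sup>2 / ((X q)\<^sup>2 * Y q))"
  unfolding set_lebesgue_integral_def using assms
  by (intro Bochner_Integration.integral_nonneg) (auto simp: indicator_def less_imp_le)

text \<open>The integrand is continuous and nonnegative, so a vanishing integral over a
  nondegenerate interval makes it vanish everywhere.\<close>

lemma integral_square_remainder_eq_0:
  fixes X Y :: "real \<Rightarrow> real"
  assumes "a < b" "continuous_on {a..b} X" "continuous_on {a..b} Y"
    and pos: "\<And>q. q \<in> {a..b} \<Longrightarrow> 0 < X q" "\<And>q. q \<in> {a..b} \<Longrightarrow> 0 < Y q"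
    and zero: "(LBINT q:{a..b}. (Y q - X q)\<^sup>2 / ((X q)\<^sup>2 * Y q)) = 0" and q: "q \<in> {a..b}"
  shows "Y q = X q"
proof -
  have ne: "X q \<noteq> 0" "Y q \<noteq> 0" if "q \<in> {a..b}" for q
    using pos[OF that] by auto
  have c: "continuous_on {a..b} (\<lambda>q. (Y q - X q)\<^sup>2 / ((X q)\<^sup>2 * Y q))"
    using ne by (auto intro!: continuous_intros assms)
  have "integral {a..b} (\<lambda>q. (Y q - X q)\<^sup>2 / ((X q)\<^sup>2 * Y q)) = 0"
    using zero set_borel_integral_eq_integral(2)[OF borel_integrable_atLeastAtMost'[OF c]] by simp
  then have "(Y q - X q)\<^sup>2 / ((X q)\<^sup>2 * Y q) = 0"
    using integral_eq_0_iff[OF c \<open>a < b\<close>] q pos(2) by (simp add: less_imp_le)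
  then show ?thesis using ne[OF q] by simp
qed

section \<open>Cutoffs and tail masses of functions in the Parisi domain\<close>

lemma parisi_domainD:
  assumes "x \<in> parisi_domain"
  shows "mono_on {0..1} x" "\<And>t. t \<in> {0..1} \<Longrightarrow> 0 \<le> x t" "\<And>t. t \<in> {0..1} \<Longrightarrow> x t \<le> 1"
    "\<And>t. t \<in> {0..<1} \<Longrightarrow> continuous (at_right t) x"
    "x \<in> extensional {0..1}" "\<exists>h\<in>{0..<1}. x h = 1"
  using assms by (auto simp: parisi_domain_def PiE_def Pi_def)

lemma parisi_domain_eq_1:
  assumes "x \<in> parisi_domain" "0 \<le> h" "x h = 1" "t \<in> {h..1}"
  shows "x t = 1"
  using parisi_domainD(3)[OF assms(1), of t] mono_onD[OF parisi_domainD(1)[OF assms(1)], of h t] assms(2-)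
  by auto

lemma parisi_domain_common_cutoff:
  assumes "x \<in> parisi_domain" "y \<in> parisi_domain"
  obtains h where "h \<in> {0<..<1}" "x h = 1" "y h = 1"
proof -
  obtain h k where h: "h \<in> {0..<1}" "x h = 1" and k: "k \<in> {0..<1}" "y k = 1"
    using parisi_domainD(6) assms by meson
  \<comment> \<open>The entry 1/2 keeps the common cutoff positive, so that [0, m] is a
    nondegenerate interval.\<close>
  define m where "m = max (1/2) (max h k)"
  have "x m = 1" "y m = 1"
    using h k parisi_domain_eq_1[OF assms(1), of h m] parisi_domain_eq_1[OF assms(2), of k m]
    by (auto simp: m_def)
  then show thesis using h k by (intro that[of m]) (auto simp: m_def)
qed

lemma set_integrable_parisi_domain:
  assumes "x \<in> parisi_domain" "0 \<le> a" "b \<le> 1"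
  shows "set_integrable lborel {a..b} x"
  using set_integrable_mono_on[OF parisi_domainD(1)[OF assms(1)]] assms(2,3)
  by (auto intro: set_integrable_subset)

lemma tail_mass_cutoff:
  assumes "x \<in> parisi_domain" "0 \<le> h" "x h = 1" "q \<in> {h..1}"
  shows "tail_mass x q = 1 - q"
proof -
  have "tail_mass x q = (LBINT s:{q..1}. 1)"
    unfolding tail_mass_def using assms parisi_domain_eq_1[OF assms(1-3)]
    by (intro set_lebesgue_integral_cong) auto
  then show ?thesis using assms by (simp add: set_integral_const)
qed

lemma tail_mass_le:
  assumes "x \<in> parisi_domain" "q \<in> {0..1}"
  shows "tail_mass x q \<le> 1 - q"
proof -
  have "tail_mass x q \<le> (LBINT s:{q..1}. 1)"
    unfolding tail_mass_def using assms
    by (intro set_integral_mono set_integrable_parisi_domain borel_integrable_atLeastAtMost')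
       (auto intro: parisi_domainD(3))
  then show ?thesis using assms by (simp add: set_integral_const)
qed

lemma tail_mass_split:
  assumes "x \<in> parisi_domain" "0 \<le> q" "q \<le> r" "r \<le> 1"
  shows "tail_mass x q = (LBINT s:{q..r}. x s) + tail_mass x r"
  unfolding tail_mass_def using assms
  by (intro set_integral_split set_integrable_parisi_domain) auto

lemma tail_mass_ge_cutoff:
  assumes "x \<in> parisi_domain" "0 \<le> h" "h \<le> 1" "x h = 1" "q \<in> {0..h}"
  shows "1 - h \<le> tail_mass x q"
proof -
  have "0 \<le> (LBINT s:{q..h}. x s)"
    unfolding set_lebesgue_integral_def using assms parisi_domainD(2)[OF assms(1)]
    by (intro Bochner_Integration.integral_nonneg) (auto simp: indicator_def)
  then show ?thesis
    using tail_mass_split[OF assms(1), of q h] tail_mass_cutoff[OF assms(1), of h h] assms by auto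
qed

lemma tail_mass_pos:
  assumes "x \<in> parisi_domain" "q \<in> {0..<1}"
  shows "0 < tail_mass x q"
proof -
  obtain h where h: "h \<in> {0..<1}" "x h = 1"
    using parisi_domainD(6)[OF assms(1)] by blast
  show ?thesis
    using tail_mass_ge_cutoff[OF assms(1), of h q] tail_mass_cutoff[OF assms(1), of h q] h assms(2)
    by (cases "q \<le> h") auto
qed

lemma continuous_on_tail_mass:
  assumes "x \<in> parisi_domain"
  shows "continuous_on {0..1} (tail_mass x)"
  unfolding tail_mass_def[abs_def] using assms
  by (intro continuous_on_upper_integral set_integrable_parisi_domain) auto

text \<open>Beyond the cutoff the tail mass is 1 - q, and the integral of 1/(1 - q) over [h, k]
  compensates exactly the change of the logarithm. This is the independence of the choice of
  cutoff.\<close>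

lemma energy_cutoff_le:
  assumes x: "x \<in> parisi_domain" and h: "0 \<le> h" "x h = 1" and k: "h \<le> k" "k < 1"
  shows "energy w k x = energy w h x"
proof -
  have c: "continuous_on {0..k} (\<lambda>q. 1 / tail_mass x q)"
    using k h by (intro continuous_on_divide continuous_on_const
        continuous_on_subset[OF continuous_on_tail_mass[OF x]] ballI
        less_imp_neq[OF tail_mass_pos[OF x], symmetric]) auto
  have "(LBINT q:{0..k}. 1 / tail_mass x q) =
      (LBINT q:{0..h}. 1 / tail_mass x q) + (LBINT q:{h..k}. 1 / tail_mass x q)"
    using h k by (intro set_integral_split borel_integrable_atLeastAtMost' c) auto
  moreover have "(LBINT q:{h..k}. 1 / tail_mass x q) = (LBINT q:{h..k}. 1 / (1 - q))"
    using tail_mass_cutoff[OF x h] k by (intro set_lebesgue_integral_cong) auto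
  moreover have "(LBINT q:{h..k}. 1 / (1 - q)) = - ln (1 - k) - (- ln (1 - h))"
    unfolding set_lebesgue_integral_def
    by (rule integral_FTC_Icc)
       (use k in \<open>auto intro!: derivative_eq_intros continuous_intros simp: has_real_derivative_iff_has_vector_derivative[symmetric]\<close>)
  ultimately show ?thesis by (simp add: energy_def)
qed

lemma energy_cutoff_eq:
  assumes "x \<in> parisi_domain" "h \<in> {0..<1}" "x h = 1" "k \<in> {0..<1}" "x k = 1"
  shows "energy w k x = energy w h x"
  using energy_cutoff_le[OF assms(1), of h k] energy_cutoff_le[OF assms(1), of k h] assms
  by (cases "h \<le> k") auto

lemma parisi_functional_eq_energy:
  assumes x: "x \<in> parisi_domain" and h: "h \<in> {0..<1}" "x h = 1"
  shows "parisi_functional \<beta> x \<nu> = 1 / 2 * energy (\<lambda>q. \<beta>\<^sup>2 * deriv \<nu> q) h x"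
proof -
  define k where "k = (SOME h. h \<in> {0..<1} \<and> x h = 1)"
  have k: "k \<in> {0..<1}" "x k = 1"
    unfolding k_def using someI_ex[of "\<lambda>h. h \<in> {0..<1} \<and> x h = 1"] h by blast+
  have "(LBINT q:{0..1}. x q * (\<beta>\<^sup>2 * deriv \<nu> q)) = \<beta>\<^sup>2 * (LBINT q:{0..1}. x q * deriv \<nu> q)"
    by (simp flip: set_integral_mult_right add: mult_ac)
  then have "parisi_functional \<beta> x \<nu> = 1 / 2 * energy (\<lambda>q. \<beta>\<^sup>2 * deriv \<nu> q) k x"
    unfolding parisi_functional_def k_def[symmetric] Let_def energy_def tail_mass_def by simp
  then show ?thesis using energy_cutoff_eq[OF x k h] by simp
qed

lemma continuous_on_inverse_square_tail_mass:
  assumes "x \<in> parisi_domain" "h < 1"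
  shows "continuous_on {0..h} (\<lambda>q. 1 / (tail_mass x q)\<^sup>2)"
  using assms(2)
  by (intro continuous_on_divide continuous_on_const continuous_on_power
      continuous_on_subset[OF continuous_on_tail_mass[OF assms(1)]] ballI power_not_zero
      less_imp_neq[OF tail_mass_pos[OF assms(1)], symmetric]) auto

lemma continuous_on_variation:
  assumes "x \<in> parisi_domain" "h < 1" "continuous_on {0..1} w"
  shows "continuous_on {0..h} (first_variation w (tail_mass x))"
  unfolding first_variation_def[abs_def] using assms
  by (intro continuous_intros continuous_on_lower_integral borel_integrable_atLeastAtMost'
      continuous_on_inverse_square_tail_mass) (auto intro: continuous_on_subset)

text \<open>To the right of \<open>h\<close> both functions equal 1, so the perturbation lives on
  [0, h] and the logarithms cancel; there the exact expansion applies with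
  \<open>e = 0\<close>.\<close>

lemma energy_diff:
  assumes x: "x \<in> parisi_domain" and y: "y \<in> parisi_domain" and h: "h \<in> {0..<1}" "x h = 1" "y h = 1"
    and w: "continuous_on {0..1} w"
  shows "energy w h y - energy w h x =
    (LBINT s:{0..h}. first_variation w (tail_mass x) s * (y s - x s)) +
    (LBINT q:{0..h}. (tail_mass y q - tail_mass x q)\<^sup>2 / ((tail_mass x q)\<^sup>2 * tail_mass y q))"
proof -
  define G where "G s = (LBINT q:{0..s}. 1 / (tail_mass x q)\<^sup>2)" for s
  have G: "continuous_on {0..h} G"
    unfolding G_def using h x
    by (intro continuous_on_lower_integral borel_integrable_atLeastAtMost' continuous_on_inverse_square_tail_mass) auto
  have wh: "continuous_on {0..h} w"
    using w h by (auto intro: continuous_on_subset)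
  have d: "set_integrable lborel {a..b} (\<lambda>s. y s - x s)" if "0 \<le> a" "b \<le> 1" for a b
    using that x y by (intro set_integral_diff set_integrable_parisi_domain)
  have yw: "set_integrable lborel {0..1} (\<lambda>s. y s * w s)" and xw: "set_integrable lborel {0..1} (\<lambda>s. x s * w s)"
    using x y w by (auto intro!: set_integrable_mult_continuous_on set_integrable_parisi_domain)
  have dw: "set_integrable lborel {0..1} (\<lambda>s. (y s - x s) * w s)"
    using w by (auto intro!: set_integrable_mult_continuous_on d)
  have exp: "(LBINT q:{0..h}. 1 / tail_mass y q) = (LBINT q:{0..h}. 1 / tail_mass x q)
    - (LBINT s:{0..h}. (y s - x s) * G s) - 0 * (LBINT q:{0..h}. 1 / (tail_mass x q)\<^sup>2)
    + (LBINT q:{0..h}. (tail_mass y q - tail_mass x q)\<^sup>2 / ((tail_mass x q)\<^sup>2 * tail_mass y q))"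
    unfolding G_def
  proof (rule integral_inverse_expansion(1)[where e=0])
    show "continuous_on {0..h} (tail_mass x)"
      using h by (auto intro: continuous_on_subset[OF continuous_on_tail_mass[OF x]])
    fix q assume q: "q \<in> {0..h}"
    have "(LBINT s:{q..h}. y s - x s) = (LBINT s:{q..h}. y s) - (LBINT s:{q..h}. x s)"
      using q h x y by (intro set_integral_diff set_integrable_parisi_domain) auto
    then show "tail_mass y q = tail_mass x q + (LBINT s:{q..h}. y s - x s) + 0"
      using tail_mass_split[OF x, of q h] tail_mass_split[OF y, of q h]
        tail_mass_cutoff[OF x, of h h] tail_mass_cutoff[OF y, of h h] q h by auto
  qed (use d tail_mass_pos x y h in auto)
  have "(LBINT s:{0..1}. y s * w s) - (LBINT s:{0..1}. x s * w s) = (LBINT s:{0..1}. (y s - x s) * w s)"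
    unfolding left_diff_distrib by (rule set_integral_diff(2)[OF yw xw, symmetric])
  also have "\<dots> = (LBINT s:{0..h}. (y s - x s) * w s) + (LBINT s:{h..1}. (y s - x s) * w s)"
    using h by (intro set_integral_split dw) auto
  also have "(LBINT s:{h..1}. (y s - x s) * w s) = (LBINT s:{h..1}. 0)"
    using parisi_domain_eq_1[OF x _ h(2)] parisi_domain_eq_1[OF y _ h(3)] h
    by (intro set_lebesgue_integral_cong) auto
  finally have "energy w h y - energy w h x =
      (LBINT s:{0..h}. (y s - x s) * w s) - (LBINT s:{0..h}. (y s - x s) * G s)
    + (LBINT q:{0..h}. (tail_mass y q - tail_mass x q)\<^sup>2 / ((tail_mass x q)\<^sup>2 * tail_mass y q))"
    unfolding energy_def exp by simp
  also have "(LBINT s:{0..h}. (y s - x s) * w s) - (LBINT s:{0..h}. (y s - x s) * G s)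
      = (LBINT s:{0..h}. (y s - x s) * w s - (y s - x s) * G s)"
    using h by (intro set_integral_diff(2)[symmetric] set_integrable_mult_continuous_on d wh G) auto
  also have "\<dots> = (LBINT s:{0..h}. first_variation w (tail_mass x) s * (y s - x s))"
    by (intro set_lebesgue_integral_cong) (auto simp: first_variation_def G_def[symmetric] algebra_simps)
  finally show ?thesis .
qed

text \<open>By \<open>energy_diff\<close> the energy gap is the first order term plus a nonnegative
  remainder, so \<open>x\<close> is minimal. In the case of equality the remainder is 0, the tail
  masses agree, and right continuity and extensionality give \<open>y = x\<close>; this uniqueness
  is what evaluates the \<open>THE\<close>.\<close>

lemma parisi_distribution_eqI:
  assumes x: "x \<in> parisi_domain" and w: "continuous_on {0..1} (deriv \<nu>)"
    and first_order: "\<And>y h. y \<in> parisi_domain \<Longrightarrow> h \<in> {0<..<1} \<Longrightarrow> x h = 1 \<Longrightarrow> y h = 1 \<Longrightarrow>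
      0 \<le> (LBINT s:{0..h}. first_variation (\<lambda>q. \<beta>\<^sup>2 * deriv \<nu> q) (tail_mass x) s * (y s - x s))"
  shows "parisi_distribution \<beta> \<nu> = x"
proof -
  define w where "w q = \<beta>\<^sup>2 * deriv \<nu> q" for q
  have wc: "continuous_on {0..1} w"
    unfolding w_def[abs_def] by (intro continuous_intros w)
  have *: "parisi_functional \<beta> x \<nu> \<le> parisi_functional \<beta> y \<nu> \<and>
      (parisi_functional \<beta> x \<nu> = parisi_functional \<beta> y \<nu> \<longrightarrow> y = x)" if y: "y \<in> parisi_domain" for y
  proof -
    obtain h where h: "h \<in> {0<..<1}" "x h = 1" "y h = 1"
      using parisi_domain_common_cutoff[OF x y] .
    then have h': "h \<in> {0..<1}" by auto
    have P: "parisi_functional \<beta> x \<nu> = 1 / 2 * energy w h x" "parisi_functional \<beta> y \<nu> = 1 / 2 * energy w h y"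
      unfolding w_def by (intro parisi_functional_eq_energy x y h' h)+
    have pos: "0 < tail_mass x q" "0 < tail_mass y q" if "q \<in> {0..h}" for q
      using that tail_mass_pos x y h by auto
    let ?R = "LBINT q:{0..h}. (tail_mass y q - tail_mass x q)\<^sup>2 / ((tail_mass x q)\<^sup>2 * tail_mass y q)"
    have R: "0 \<le> ?R"
      by (rule integral_square_remainder_nonneg) (use pos in auto)
    note diff = energy_diff[OF x y h' h(2,3) wc]
    note fo = first_order[OF y h, folded w_def]
    have "y = x" if "energy w h x = energy w h y"
    proof -
      have R0: "?R = 0"
        using diff fo R that by linarith
      have eq: "tail_mass y q = tail_mass x q" if "q \<in> {0..h}" for q
      proof (rule integral_square_remainder_eq_0[of 0 h "tail_mass x" "tail_mass y"])
        show "continuous_on {0..h} (tail_mass x)" "continuous_on {0..h} (tail_mass y)"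
          using h(1) by (auto intro: continuous_on_subset[OF continuous_on_tail_mass[OF x]]
              continuous_on_subset[OF continuous_on_tail_mass[OF y]])
      qed (use h(1) pos that R0 in auto)
      have int: "set_integrable lborel {0..h} (\<lambda>s. y s - x s)"
        using h x y by (intro set_integral_diff set_integrable_parisi_domain) auto
      have zero: "(LBINT s:{q..h}. y s - x s) = 0" if q: "q \<in> {0..h}" for q
      proof -
        have "(LBINT s:{q..h}. y s - x s) = (LBINT s:{q..h}. y s) - (LBINT s:{q..h}. x s)"
          using q h x y by (intro set_integral_diff set_integrable_parisi_domain) auto
        then show ?thesis
          using tail_mass_split[OF x, of q h] tail_mass_split[OF y, of q h] eq[of q] eq[of h] q h by auto
      qed
      have "y t - x t = 0" if "t \<in> {0..<h}" for t
      proof (rule eq_0_if_upper_integrals_eq_0[OF int that])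
        show "continuous (at_right t) (\<lambda>s. y s - x s)"
          using that h(1) by (intro continuous_diff parisi_domainD(4)[OF x] parisi_domainD(4)[OF y]) auto
      qed (use zero in auto)
      moreover have "y t - x t = 0" if "t \<in> {h..1}" for t
        using parisi_domain_eq_1[OF x _ h(2) that] parisi_domain_eq_1[OF y _ h(3) that] h(1) by simp
      ultimately have "y t = x t" if "t \<in> {0..1}" for t
        using that by (cases "t < h") auto
      then show ?thesis
        by (intro extensionalityI[OF parisi_domainD(5)[OF y] parisi_domainD(5)[OF x]])
    qed
    moreover have "energy w h x \<le> energy w h y" using diff fo R by linarith
    ultimately show ?thesis unfolding P by auto
  qed
  show ?thesis
    unfolding parisi_distribution_def
  proof (rule the_equality)
    show "is_arg_min (\<lambda>y. parisi_functional \<beta> y \<nu>) (\<lambda>y. y \<in> parisi_domain) x"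
      using * x by (auto simp: is_arg_min_linorder)
    fix z assume "is_arg_min (\<lambda>y. parisi_functional \<beta> y \<nu>) (\<lambda>y. y \<in> parisi_domain) z"
    then have "z \<in> parisi_domain" "parisi_functional \<beta> z \<nu> \<le> parisi_functional \<beta> x \<nu>"
      using x by (auto simp: is_arg_min_linorder)
    then show "z = x" using *[of z] by linarith
  qed
qed

section \<open>Existence of the Parisi distribution\<close>

lemma set_integral_tendsto_bounded:
  fixes f :: "nat \<Rightarrow> real \<Rightarrow> real"
  assumes "\<And>n. set_borel_measurable lborel {a..b} (f n)" "set_borel_measurable lborel {a..b} g"
    and "\<And>n t. t \<in> {a..b} \<Longrightarrow> \<bar>f n t\<bar> \<le> B"
    and "AE t in lborel. t \<in> {a..b} \<longrightarrow> (\<lambda>n. f n t) \<longlonglongrightarrow> g t"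
  shows "(\<lambda>n. LBINT t:{a..b}. f n t) \<longlonglongrightarrow> (LBINT t:{a..b}. g t)"
  unfolding set_lebesgue_integral_def
proof (rule integral_dominated_convergence[where w="\<lambda>t. indicator {a..b} t *\<^sub>R B"])
  show "integrable lborel (\<lambda>t. indicator {a..b} t *\<^sub>R B)"
    using borel_integrable_atLeastAtMost'[of a b "\<lambda>_. B"] by (simp add: set_integrable_def)
  show "AE t in lborel. (\<lambda>n. indicat_real {a..b} t *\<^sub>R f n t) \<longlonglongrightarrow> indicat_real {a..b} t *\<^sub>R g t"
    using assms(4) by eventually_elim (auto simp: indicator_def)
  show "AE t in lborel. norm (indicat_real {a..b} t *\<^sub>R f n t) \<le> indicat_real {a..b} t *\<^sub>R B" for n
    using assms(3) by (intro AE_I2) (auto simp: indicator_def)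
qed (use assms(1,2) in \<open>auto simp: set_borel_measurable_def\<close>)

lemma continuous_at_right_cong:
  fixes f g :: "real \<Rightarrow> real"
  assumes g: "continuous (at_right t) g" and t: "t < b"
    and eq: "\<And>s. t \<le> s \<Longrightarrow> s < b \<Longrightarrow> f s = g s"
  shows "continuous (at_right t) f"
proof -
  have "eventually (\<lambda>s. g s = f s) (at_right t)"
    unfolding eventually_at_right[OF t] using t eq by (intro exI[of _ b]) auto
  then have "(f \<longlongrightarrow> g t) (at_right t)"
    using g Lim_transform_eventually unfolding continuous_within by blast
  then show ?thesis using eq[of t] t by (simp add: continuous_within)
qed

section \<open>An a priori cutoff and the direct method\<close>

definition saturate_from :: "real \<Rightarrow> (real \<Rightarrow> real) \<Rightarrow> real \<Rightarrow> real" where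
  "saturate_from h x = (\<lambda>t\<in>{0..1}. if t < h then x t else 1)"

lemma saturate_from_in_parisi_domain:
  assumes x: "x \<in> parisi_domain" and h: "h \<in> {0..<1}"
  shows "saturate_from h x \<in> parisi_domain"
proof -
  have "continuous (at_right t) (saturate_from h x)" if t: "t \<in> {0..<1}" for t
  proof (cases "t < h")
    case True
    show ?thesis
      by (rule continuous_at_right_cong[OF parisi_domainD(4)[OF x t] True])
         (use t h in \<open>auto simp: saturate_from_def\<close>)
  next
    case False
    show ?thesis
      by (rule continuous_at_right_cong[OF continuous_const[of _ 1], of t 1])
         (use t False in \<open>auto simp: saturate_from_def\<close>)
  qed
  moreover have "mono_on {0..1} (saturate_from h x)"
    using parisi_domainD(1,3)[OF x] by (auto simp: mono_on_def saturate_from_def)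
  ultimately show ?thesis
    using h parisi_domainD(2,3)[OF x]
    by (auto simp: parisi_domain_def saturate_from_def intro!: bexI[of _ h])
qed

text \<open>The tail mass at s is at most 1 - s, so the subtracted integral is at least that of 1/(1
  - s)^2, which is t/(1 - t). The bound is uniform in \<open>x\<close>.\<close>

lemma first_variation_le:
  assumes x: "x \<in> parisi_domain" and t: "t \<in> {0..<1}"
  shows "first_variation w (tail_mass x) t \<le> w t - t / (1 - t)"
proof -
  have "(LBINT s:{0..t}. 1 / (1 - s)\<^sup>2) = 1 / (1 - t) - 1 / (1 - 0)"
    unfolding set_lebesgue_integral_def
    by (rule integral_FTC_Icc)
       (use t in \<open>auto intro!: derivative_eq_intros continuous_intros simp: power2_eq_square
          has_real_derivative_iff_has_vector_derivative[symmetric]\<close>)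
  also have "\<dots> = t / (1 - t)" using t by (simp add: field_simps)
  finally have "t / (1 - t) = (LBINT s:{0..t}. 1 / (1 - s)\<^sup>2)" ..
  also have "\<dots> \<le> (LBINT s:{0..t}. 1 / (tail_mass x s)\<^sup>2)"
  proof (rule set_integral_mono)
    show "set_integrable lborel {0..t} (\<lambda>s. 1 / (1 - s)\<^sup>2)"
      using t by (intro borel_integrable_atLeastAtMost' continuous_intros) auto
    show "set_integrable lborel {0..t} (\<lambda>s. 1 / (tail_mass x s)\<^sup>2)"
      using t x by (intro borel_integrable_atLeastAtMost' continuous_on_inverse_square_tail_mass) auto
    show "1 / (1 - s)\<^sup>2 \<le> 1 / (tail_mass x s)\<^sup>2" if "s \<in> {0..t}" for s
      using that t tail_mass_le[OF x, of s] tail_mass_pos[OF x, of s]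
      by (intro divide_left_mono power_mono mult_pos_pos zero_less_power) auto
  qed
  finally show ?thesis by (simp add: first_variation_def)
qed

text \<open>The expansion is made around the saturated function, not around \<open>x\<close>: past
  \<open>h\<close> its first variation and the difference \<open>x s - y s\<close> are both
  nonpositive, and before \<open>h\<close> the difference is 0. The threshold
  \<open>M / (1 + M)\<close> is where t/(1 - t) reaches \<open>M\<close>.\<close>

lemma energy_saturate_from_le:
  assumes x: "x \<in> parisi_domain" and w: "continuous_on {0..1} w"
    and M: "0 \<le> M" "\<And>t. t \<in> {0..1} \<Longrightarrow> w t \<le> M" and h: "M / (1 + M) \<le> h" "h < 1"
    and k: "k \<in> {0..<1}" "x k = 1" "saturate_from h x k = 1"
  shows "energy w k (saturate_from h x) \<le> energy w k x"
proof -
  have "0 \<le> M / (1 + M)" using M(1) by simp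
  then have h0: "0 \<le> h" using h by linarith
  define y where "y = saturate_from h x"
  have y: "y \<in> parisi_domain"
    unfolding y_def using h h0 by (intro saturate_from_in_parisi_domain x) auto
  have "0 \<le> (LBINT s:{0..k}. first_variation w (tail_mass y) s * (x s - y s))"
    unfolding set_lebesgue_integral_def
  proof (rule Bochner_Integration.integral_nonneg)
    fix s
    have "0 \<le> first_variation w (tail_mass y) s * (x s - y s)" if s: "s \<in> {0..k}"
    proof (cases "s < h")
      case True then show ?thesis using s k by (auto simp: y_def saturate_from_def)
    next
      case False
      have "M * (1 - s) \<le> s"
      proof -
        have "M \<le> h * (1 + M)" using h M by (simp add: pos_divide_le_eq)
        also have "\<dots> \<le> s * (1 + M)" using False M by (intro mult_right_mono) auto
        finally show ?thesis by (simp add: algebra_simps)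
      qed
      then have "M \<le> s / (1 - s)" using s k by (simp add: pos_le_divide_eq)
      then have "first_variation w (tail_mass y) s \<le> 0"
        using first_variation_le[OF y, of s w] M(2)[of s] s k by auto
      moreover have "x s - y s \<le> 0"
        using False s k parisi_domainD(3)[OF x, of s] by (auto simp: y_def saturate_from_def)
      ultimately show ?thesis by (rule mult_nonpos_nonpos)
    qed
    then show "0 \<le> indicat_real {0..k} s *\<^sub>R (first_variation w (tail_mass y) s * (x s - y s))"
      by (auto simp: indicator_def)
  qed
  moreover have "0 \<le> (LBINT q:{0..k}. (tail_mass x q - tail_mass y q)\<^sup>2 / ((tail_mass y q)\<^sup>2 * tail_mass x q))"
    using k by (intro integral_square_remainder_nonneg tail_mass_pos x) auto
  ultimately show ?thesis
    using energy_diff[OF y x k(1) _ k(2) w] k(3) unfolding y_def by linarith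
qed

text \<open>Helly's theorem gives convergence at the continuity points of a monotone
  right-continuous limit, hence almost everywhere. The common cutoff \<open>h\<close> keeps the
  limit in the domain.\<close>

lemma parisi_domain_compact:
  fixes y :: "nat \<Rightarrow> real \<Rightarrow> real"
  assumes y: "\<And>n. y n \<in> parisi_domain" "\<And>n. y n h = 1" and h: "h \<in> {0..<1}"
  obtains r x where "strict_mono (r :: nat \<Rightarrow> nat)" "x \<in> parisi_domain" "x h = 1"
    "AE t in lborel. t \<in> {0..1} \<longrightarrow> (\<lambda>n. y (r n) t) \<longlonglongrightarrow> x t"
proof -
  \<comment> \<open>Helly's theorem concerns functions on the whole line, so each \<open>y n\<close>
    is continued by 0 to the left and by 1 to the right.\<close>
  define f where "f n t = (if t < 0 then 0 else if 1 \<le> t then 1 else y n t)" for n t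
  have "mono (f n)" for n
  proof (rule monoI)
    fix s t :: real assume "s \<le> t"
    then show "f n s \<le> f n t"
      using parisi_domainD(2,3)[OF y(1)[of n]] mono_onD[OF parisi_domainD(1)[OF y(1)[of n]], of s t]
      by (auto simp: f_def)
  qed
  moreover have "continuous (at_right t) (f n)" for n t
  proof -
    consider "t < 0" | "t \<in> {0..<1}" | "1 \<le> t" by fastforce
    then show ?thesis
    proof cases
      case 1
      then show ?thesis
        by (intro continuous_at_right_cong[OF continuous_const[of _ 0], of t 0]) (auto simp: f_def)
    next
      case 2
      then show ?thesis
        by (intro continuous_at_right_cong[OF parisi_domainD(4)[OF y(1) 2], of 1]) (auto simp: f_def)
    next
      case 3
      then show ?thesis
        by (intro continuous_at_right_cong[OF continuous_const[of _ 1], of t "t + 1"]) (auto simp: f_def)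
    qed
  qed
  moreover have f01: "0 \<le> f n t" "f n t \<le> 1" for n t
    using parisi_domainD(2,3)[OF y(1)[of n]] by (auto simp: f_def)
  ultimately obtain r F where r: "strict_mono (r :: nat \<Rightarrow> nat)"
    and F: "\<And>t. continuous (at_right t) F" "mono F" "\<And>t. \<bar>F t\<bar> \<le> 1"
    and lim: "\<And>t. isCont F t \<Longrightarrow> (\<lambda>n. f (r n) t) \<longlonglongrightarrow> F t"
    using Helly_selection[of f 1] by (auto simp: abs_le_iff)
  \<comment> \<open>A monotone function has countably many discontinuities, so its continuity points
    are dense.\<close>
  have cont_point: "\<exists>t\<in>{a<..<b}. isCont F t" if "a < b" for a b
    using open_minus_countable[OF mono_ctble_discont[OF F(2)], of "{a<..<b}"] that by auto
  have F0: "0 \<le> F t" for t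
  proof -
    obtain s where "s \<in> {t - 1<..<t}" "isCont F s" using cont_point[of "t - 1" t] by auto
    moreover from this have "0 \<le> F s" using lim[of s] f01 by (auto intro: LIMSEQ_le_const)
    ultimately show ?thesis using monoD[OF F(2), of s t] by auto
  qed
  \<comment> \<open>Convergence at \<open>h\<close> itself is not guaranteed. If the limit were
    below 1 there, right continuity would give a continuity point to the right of \<open>h\<close>
    with limit below 1, where every \<open>f n\<close> is 1.\<close>
  have Fh: "F h = 1"
  proof (rule ccontr)
    assume "F h \<noteq> 1"
    then have "F h < 1" using F(3)[of h] by auto
    then have "eventually (\<lambda>t. F t < 1) (at_right h)"
      using F(1)[of h] unfolding continuous_within by (rule order_tendstoD(2)[rotated])
    then obtain b where b: "h < b" "\<And>t. h < t \<Longrightarrow> t < b \<Longrightarrow> F t < 1"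
      by (auto simp: eventually_at_right[of h "h + 1"])
    then obtain t where t: "t \<in> {h<..<b}" "isCont F t" using cont_point[OF b(1)] by blast
    have "f n t = 1" for n
      using t h parisi_domain_eq_1[OF y(1) _ y(2), of t n] by (auto simp: f_def)
    then have "F t = 1" using lim[OF t(2)] by (simp add: LIMSEQ_const_iff)
    then show False using b t by fastforce
  qed
  define x where "x = restrict F {0..1}"
  have "continuous (at_right t) x" if t: "t \<in> {0..<1}" for t
    by (rule continuous_at_right_cong[OF F(1), of t 1]) (use t in \<open>auto simp: x_def\<close>)
  then have x: "x \<in> parisi_domain" "x h = 1"
    using F0 F(3) h Fh monoD[OF F(2)] abs_le_D1[OF F(3)]
    by (auto simp: parisi_domain_def x_def mono_on_def intro!: bexI[of _ h])
  have "AE t in lborel. t \<notin> {t. \<not> isCont F t} \<union> {1}"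
    using mono_ctble_discont[OF F(2)] by (intro AE_not_in countable_imp_null_set_lborel) simp
  then have "AE t in lborel. t \<in> {0..1} \<longrightarrow> (\<lambda>n. y (r n) t) \<longlonglongrightarrow> x t"
  proof eventually_elim
    case (elim t)
    then show ?case using lim[of t] by (auto simp: f_def x_def)
  qed
  then show thesis using that r x by blast
qed

text \<open>Direct method: compactness gives an almost everywhere limit of a minimizing sequence,
  and each term of the energy converges by dominated convergence. The common cutoff bounds the
  inverse tail masses by \<open>1 / (1 - h)\<close> on [0, h].\<close>

lemma exists_energy_min_cutoff:
  assumes w: "continuous_on {0..1} w" and h: "h \<in> {0..<1}"
  obtains x where "x \<in> parisi_domain" "x h = 1"
    "\<And>y. y \<in> parisi_domain \<Longrightarrow> y h = 1 \<Longrightarrow> energy w h x \<le> energy w h y"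
proof -
  define S where "S = {y \<in> parisi_domain. y h = 1}"
  have "continuous (at_right t) (\<lambda>t\<in>{0..1}. 1 :: real)" if "t \<in> {0..<1}" for t :: real
    by (rule continuous_at_right_cong[OF continuous_const[of _ 1], of t 1]) (use that in auto)
  then have "(\<lambda>t\<in>{0..1}. 1) \<in> parisi_domain"
    using h by (auto simp: parisi_domain_def mono_on_def intro!: bexI[of _ h])
  then have S0: "S \<noteq> {}" using h by (auto simp: S_def)
  have "bounded (w ` {0..1})"
    using w by (intro compact_imp_bounded compact_continuous_image) auto
  then obtain M where M: "\<And>t. t \<in> {0..1} \<Longrightarrow> \<bar>w t\<bar> \<le> M"
    unfolding bounded_real by blast
  have M0: "0 \<le> M" using order_trans[OF abs_ge_zero M, of 0] by simp
  have yw: "\<bar>y t * w t\<bar> \<le> M" if "y \<in> parisi_domain" "t \<in> {0..1}" for y t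
    using mult_mono[OF parisi_domainD(3)[OF that] M[OF that(2)]] parisi_domainD(2)[OF that]
    by (auto simp: abs_mult)
  have ywi: "set_integrable lborel {0..1} (\<lambda>s. y s * w s)" if "y \<in> parisi_domain" for y
    using that w by (auto intro!: set_integrable_mult_continuous_on set_integrable_parisi_domain)
  have bdd: "bdd_below (energy w h ` S)"
  proof (rule bdd_belowI2)
    fix y assume "y \<in> S"
    then have y: "y \<in> parisi_domain" by (simp add: S_def)
    have "(LBINT q:{0..1::real}. - M) \<le> (LBINT q:{0..1}. y q * w q)"
      using yw[OF y, THEN abs_le_D2, THEN le_imp_neg_le]
      by (intro set_integral_mono ywi y borel_integrable_atLeastAtMost')
         auto
    moreover have "0 \<le> (LBINT q:{0..h}. 1 / tail_mass y q)"
      unfolding set_lebesgue_integral_def using tail_mass_pos[OF y] h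
      by (intro Bochner_Integration.integral_nonneg) (auto simp: indicator_def less_imp_le)
    ultimately show "- M + ln (1 - h) \<le> energy w h y"
      by (simp add: energy_def set_integral_const)
  qed
  define I where "I = (INF y\<in>S. energy w h y)"
  have "\<exists>y\<in>S. energy w h y < I + 1 / real (Suc n)" for n
    using cINF_less_iff[OF S0 bdd, of "I + 1 / real (Suc n)"] by (simp add: I_def)
  then obtain y where yS: "\<And>n. y n \<in> S" and yI: "\<And>n. energy w h (y n) < I + 1 / real (Suc n)"
    by metis
  have y: "\<And>n. y n \<in> parisi_domain" "\<And>n. y n h = 1" using yS by (auto simp: S_def)
  obtain r x where r: "strict_mono (r :: nat \<Rightarrow> nat)" and x: "x \<in> parisi_domain" "x h = 1"
    and lim: "AE t in lborel. t \<in> {0..1} \<longrightarrow> (\<lambda>n. y (r n) t) \<longlonglongrightarrow> x t"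
    by (rule parisi_domain_compact[OF y h])
  have meas: "set_borel_measurable lborel A f" if "set_integrable lborel A f" for A and f :: "real \<Rightarrow> real"
    using that unfolding set_integrable_def set_borel_measurable_def
    by (auto dest: borel_measurable_integrable)
  have "(\<lambda>n. LBINT s:{0..1}. y (r n) s * w s) \<longlonglongrightarrow> (LBINT s:{0..1}. x s * w s)"
  proof (rule set_integral_tendsto_bounded[where B=M])
    show "AE t in lborel. t \<in> {0..1} \<longrightarrow> (\<lambda>n. y (r n) t * w t) \<longlonglongrightarrow> x t * w t"
      using lim by eventually_elim (auto intro!: tendsto_intros)
  qed (use yw y(1) ywi meas x in auto)
  moreover have tl: "(\<lambda>n. tail_mass (y (r n)) q) \<longlonglongrightarrow> tail_mass x q" if q: "q \<in> {0..1}" for q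
    unfolding tail_mass_def
  proof (rule set_integral_tendsto_bounded[where B=1])
    show "AE t in lborel. t \<in> {q..1} \<longrightarrow> (\<lambda>n. y (r n) t) \<longlonglongrightarrow> x t"
      using lim by eventually_elim (use q in auto)
    show "\<bar>y (r n) t\<bar> \<le> 1" if "t \<in> {q..1}" for n t
      using parisi_domainD(2,3)[OF y(1), of t "r n"] that q by auto
  qed (use y(1) meas x q in \<open>auto intro!: set_integrable_parisi_domain\<close>)
  have inv: "set_integrable lborel {0..h} (\<lambda>q. 1 / tail_mass z q)" if z: "z \<in> parisi_domain" for z
    using h by (intro borel_integrable_atLeastAtMost' continuous_on_divide continuous_on_const
        continuous_on_subset[OF continuous_on_tail_mass[OF z]] ballI
        less_imp_neq[OF tail_mass_pos[OF z], symmetric]) auto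
  have "(\<lambda>n. LBINT q:{0..h}. 1 / tail_mass (y (r n)) q) \<longlonglongrightarrow> (LBINT q:{0..h}. 1 / tail_mass x q)"
  proof (rule set_integral_tendsto_bounded[where B="1 / (1 - h)"])
    show "AE q in lborel. q \<in> {0..h} \<longrightarrow> (\<lambda>n. 1 / tail_mass (y (r n)) q) \<longlonglongrightarrow> 1 / tail_mass x q"
      using h tail_mass_pos[OF x(1)] by (intro AE_I2 impI tendsto_divide tl tendsto_const) (auto simp: less_le)
    show "\<bar>1 / tail_mass (y (r n)) q\<bar> \<le> 1 / (1 - h)" if q: "q \<in> {0..h}" for n q
    proof -
      have "1 - h \<le> tail_mass (y (r n)) q"
        using tail_mass_ge_cutoff[OF y(1) _ _ y(2)] q h by auto
      then show ?thesis using h by (auto intro!: divide_left_mono mult_pos_pos)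
    qed
  qed (use meas inv y x in auto)
  ultimately have "(\<lambda>n. energy w h (y (r n))) \<longlonglongrightarrow> energy w h x"
    unfolding energy_def by (intro tendsto_add tendsto_const)
  moreover have "(\<lambda>n. I + inverse (real (Suc (r n)))) \<longlonglongrightarrow> I"
    using LIMSEQ_subseq_LIMSEQ[OF LIMSEQ_inverse_real_of_nat_add[of I] r] by (simp add: o_def)
  moreover have "energy w h (y (r n)) \<le> I + inverse (real (Suc (r n)))" for n
    using yI[of "r n"] by (simp add: inverse_eq_divide)
  ultimately have "energy w h x \<le> I"
    by (intro LIMSEQ_le) blast+
  moreover have "I \<le> energy w h z" if "z \<in> parisi_domain" "z h = 1" for z
    unfolding I_def using that by (intro cINF_lower[OF bdd]) (simp add: S_def)
  ultimately show thesis using that[OF x] by fastforce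
qed

text \<open>Saturating at \<open>k\<close> never raises the energy, so a minimizer among functions
  with cutoff \<open>k\<close> beats every competitor. The chain switches between the cutoffs
  \<open>h\<close> and \<open>k\<close>, since minimality is known at \<open>k\<close> only.\<close>

lemma exists_energy_min:
  assumes w: "continuous_on {0..1} w"
  obtains x where "x \<in> parisi_domain"
    "\<And>y h. y \<in> parisi_domain \<Longrightarrow> h \<in> {0..<1} \<Longrightarrow> x h = 1 \<Longrightarrow> y h = 1 \<Longrightarrow> energy w h x \<le> energy w h y"
proof -
  have "bounded (w ` {0..1})"
    using w by (intro compact_imp_bounded compact_continuous_image) auto
  then obtain M where M: "\<And>t. t \<in> {0..1} \<Longrightarrow> \<bar>w t\<bar> \<le> M"
    unfolding bounded_real by blast
  have M0: "0 \<le> M" "\<And>t. t \<in> {0..1} \<Longrightarrow> w t \<le> M"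
    using order_trans[OF abs_ge_zero M, of 0] order_trans[OF abs_ge_self M] by simp_all
  define k where "k = M / (1 + M)"
  have k: "k \<in> {0..<1}" using M0(1) by (auto simp: k_def divide_less_eq)
  obtain x where x: "x \<in> parisi_domain" "x k = 1"
    and min: "\<And>y. y \<in> parisi_domain \<Longrightarrow> y k = 1 \<Longrightarrow> energy w k x \<le> energy w k y"
    by (rule exists_energy_min_cutoff[OF w k]) (rule that)
  show thesis
  proof (rule that[OF x(1)])
    fix y h assume y: "y \<in> parisi_domain" and h: "h \<in> {0..<1}" "x h = 1" "y h = 1"
    let ?z = "saturate_from k y"
    have z: "?z \<in> parisi_domain" using y k by (rule saturate_from_in_parisi_domain)
    have zk: "?z k = 1" "?z h = 1" using h k by (auto simp: saturate_from_def)
    have "energy w h x = energy w k x" by (rule energy_cutoff_eq[OF x(1) k x(2) h(1,2)])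
    also have "\<dots> \<le> energy w k ?z" by (rule min[OF z zk(1)])
    also have "\<dots> = energy w h ?z" by (rule energy_cutoff_eq[OF z h(1) zk(2) k zk(1)])
    also have "\<dots> \<le> energy w h y"
      using k by (intro energy_saturate_from_le[OF y w M0] h zk) (auto simp: k_def)
    finally show "energy w h x \<le> energy w h y" .
  qed
qed

text \<open>Moving from \<open>x\<close> towards \<open>y\<close> by a fraction e changes the energy
  by e times the first order term plus a remainder of order e^2. Divide by e and let it tend to
  0.\<close>

lemma energy_min_first_order:
  assumes x: "x \<in> parisi_domain" and w: "continuous_on {0..1} w"
    and min: "\<And>y h. y \<in> parisi_domain \<Longrightarrow> h \<in> {0..<1} \<Longrightarrow> x h = 1 \<Longrightarrow> y h = 1 \<Longrightarrow> energy w h x \<le> energy w h y"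
    and y: "y \<in> parisi_domain" and h: "h \<in> {0..<1}" "x h = 1" "y h = 1"
  shows "0 \<le> (LBINT s:{0..h}. first_variation w (tail_mass x) s * (y s - x s))" (is "0 \<le> ?L")
proof -
  \<comment> \<open>On [0, h] the numerator of the remainder is at most e^2 and the denominator at
    least (1 - h)^3; the factor \<open>h\<close> is the length of the interval.\<close>
  define K where "K = h / (1 - h) ^ 3"
  have bound: "0 \<le> ?L + e * K" if e: "0 < e" "e \<le> 1" for e :: real
  proof -
    define z where "z = (\<lambda>t\<in>{0..1}. x t + e * (y t - x t))"
    have z01: "z t = (1 - e) * x t + e * y t" if "t \<in> {0..1}" for t
      using that by (simp add: z_def algebra_simps)
    have "mono_on {0..1} z"
    proof (rule mono_onI)
      fix s t :: real assume st: "s \<in> {0..1}" "t \<in> {0..1}" "s \<le> t"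
      show "z s \<le> z t"
        unfolding z01[OF st(1)] z01[OF st(2)]
        using e mono_onD[OF parisi_domainD(1)[OF x] st] mono_onD[OF parisi_domainD(1)[OF y] st]
        by (intro add_mono mult_left_mono) auto
    qed
    moreover have "z t \<in> {0..1}" if t: "t \<in> {0..1}" for t
    proof -
      have "(1 - e) * x t + e * y t \<le> (1 - e) * 1 + e * 1"
        using e parisi_domainD(3)[OF x t] parisi_domainD(3)[OF y t]
        by (intro add_mono mult_left_mono) auto
      then show ?thesis
        using e parisi_domainD(2)[OF x t] parisi_domainD(2)[OF y t] z01[OF t] by auto
    qed
    moreover have "continuous (at_right t) z" if t: "t \<in> {0..<1}" for t
    proof (rule continuous_at_right_cong[where b=1])
      show "continuous (at_right t) (\<lambda>s. x s + e * (y s - x s))"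
        by (intro continuous_intros parisi_domainD(4)[OF x t] parisi_domainD(4)[OF y t])
    qed (use t in \<open>auto simp: z_def\<close>)
    moreover have zh: "z h = 1" using h by (simp add: z_def)
    ultimately have z: "z \<in> parisi_domain"
      using h by (auto simp: parisi_domain_def z_def intro!: bexI[of _ h])
    have tz: "tail_mass z q - tail_mass x q = e * (tail_mass y q - tail_mass x q)" if q: "q \<in> {0..1}" for q
    proof -
      have i: "set_integrable lborel {q..1} x" "set_integrable lborel {q..1} y"
        using q x y by (auto intro: set_integrable_parisi_domain)
      have "tail_mass z q = (LBINT s:{q..1}. x s + e * (y s - x s))"
        unfolding tail_mass_def using q by (intro set_lebesgue_integral_cong) (auto simp: z_def)
      also have "\<dots> = (LBINT s:{q..1}. x s) + e * ((LBINT s:{q..1}. y s) - (LBINT s:{q..1}. x s))"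
        using i by (simp only: set_integral_add set_integral_diff set_integrable_mult_right set_integral_mult_right)
      finally show ?thesis by (simp add: tail_mass_def)
    qed
    have "(LBINT s:{0..h}. first_variation w (tail_mass x) s * (z s - x s)) =
        (LBINT s:{0..h}. e * (first_variation w (tail_mass x) s * (y s - x s)))"
      using h by (intro set_lebesgue_integral_cong) (auto simp: z_def)
    then have 1: "(LBINT s:{0..h}. first_variation w (tail_mass x) s * (z s - x s)) = e * ?L"
      by (simp only: set_integral_mult_right)
    have "(LBINT q:{0..h}. (tail_mass z q - tail_mass x q)\<^sup>2 / ((tail_mass x q)\<^sup>2 * tail_mass z q))
        \<le> (LBINT q:{0..h}. e\<^sup>2 / (1 - h) ^ 3)"
    proof (rule set_integral_mono)
      have "(tail_mass x q)\<^sup>2 * tail_mass z q \<noteq> 0" if "q \<in> {0..h}" for q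
        using tail_mass_pos[OF x, of q] tail_mass_pos[OF z, of q] that h by auto
      then show "set_integrable lborel {0..h}
          (\<lambda>q. (tail_mass z q - tail_mass x q)\<^sup>2 / ((tail_mass x q)\<^sup>2 * tail_mass z q))"
        using h by (intro borel_integrable_atLeastAtMost' continuous_intros
          continuous_on_subset[OF continuous_on_tail_mass[OF x]]
          continuous_on_subset[OF continuous_on_tail_mass[OF z]]) auto
      fix q assume q: "q \<in> {0..h}"
      have ge: "1 - h \<le> tail_mass x q" "1 - h \<le> tail_mass z q" "1 - h \<le> tail_mass y q"
        using tail_mass_ge_cutoff[OF x _ _ h(2), of q] tail_mass_ge_cutoff[OF y _ _ h(3), of q]
          tail_mass_ge_cutoff[OF z _ _ zh, of q] q h by auto
      have "\<bar>tail_mass y q - tail_mass x q\<bar> \<le> 1"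
        using ge tail_mass_le[OF x, of q] tail_mass_le[OF y, of q] q h by auto
      then have "(tail_mass z q - tail_mass x q)\<^sup>2 \<le> e\<^sup>2"
        using tz[of q] q h e by (simp add: power_mult_distrib abs_square_le_1 mult_left_le)
      moreover have "(1 - h) ^ 3 \<le> (tail_mass x q)\<^sup>2 * tail_mass z q"
        using mult_mono[OF power_mono[OF ge(1), of 2] ge(2)] h by (simp add: eval_nat_numeral)
      ultimately show "(tail_mass z q - tail_mass x q)\<^sup>2 / ((tail_mass x q)\<^sup>2 * tail_mass z q)
          \<le> e\<^sup>2 / (1 - h) ^ 3"
        using h by (intro frac_le) auto
    qed (auto intro!: borel_integrable_atLeastAtMost')
    also have "\<dots> = e\<^sup>2 * K" using h by (simp add: set_integral_const K_def)
    finally have "0 \<le> e * ?L + e\<^sup>2 * K"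
      using min[OF z h(1,2) zh] energy_diff[OF x z h(1,2) zh w] 1 by linarith
    then have "0 \<le> e * (?L + e * K)" by (simp add: algebra_simps power2_eq_square)
    then show ?thesis using e by (simp add: zero_le_mult_iff)
  qed
  have "((\<lambda>e. ?L + e * K) \<longlongrightarrow> ?L + 0 * K) (at_right 0)"
    by (intro tendsto_intros)
  moreover have "eventually (\<lambda>e. 0 \<le> ?L + e * K) (at_right 0)"
    using bound by (subst eventually_at_right[of 0 1]) (auto intro!: exI[of _ 1])
  ultimately have "0 \<le> ?L + 0 * K"
    by (intro tendsto_lowerbound[where F="at_right (0::real)"]) auto
  then show ?thesis by simp
qed

text \<open>Some minimizer exists and satisfies the first order condition, which in turn is
  sufficient for unique minimality. So it is the value of the \<open>THE\<close>, and the condition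
  transfers.\<close>

lemma parisi_distribution_first_order:
  assumes "continuous_on {0..1} (deriv \<nu>)"
  shows "parisi_distribution \<beta> \<nu> \<in> parisi_domain"
    and "\<And>y h. y \<in> parisi_domain \<Longrightarrow> h \<in> {0..<1} \<Longrightarrow> parisi_distribution \<beta> \<nu> h = 1 \<Longrightarrow> y h = 1 \<Longrightarrow>
      0 \<le> (LBINT s:{0..h}. first_variation (\<lambda>q. \<beta>\<^sup>2 * deriv \<nu> q) (tail_mass (parisi_distribution \<beta> \<nu>)) s
        * (y s - parisi_distribution \<beta> \<nu> s))"
proof -
  have w: "continuous_on {0..1} (\<lambda>q. \<beta>\<^sup>2 * deriv \<nu> q)"
    by (intro continuous_intros assms)
  obtain x where x: "x \<in> parisi_domain"
    and min: "\<And>y h. y \<in> parisi_domain \<Longrightarrow> h \<in> {0..<1} \<Longrightarrow> x h = 1 \<Longrightarrow> y h = 1 \<Longrightarrow>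
      energy (\<lambda>q. \<beta>\<^sup>2 * deriv \<nu> q) h x \<le> energy (\<lambda>q. \<beta>\<^sup>2 * deriv \<nu> q) h y"
    by (rule exists_energy_min[OF w]) (rule that)
  note fo = energy_min_first_order[OF x w min]
  have eq: "parisi_distribution \<beta> \<nu> = x"
    by (rule parisi_distribution_eqI[OF x assms], rule fo) simp_all
  show "parisi_distribution \<beta> \<nu> \<in> parisi_domain"
    unfolding eq by (rule x)
  show "0 \<le> (LBINT s:{0..h}. first_variation (\<lambda>q. \<beta>\<^sup>2 * deriv \<nu> q) (tail_mass (parisi_distribution \<beta> \<nu>)) s
        * (y s - parisi_distribution \<beta> \<nu> s))"
    if "y \<in> parisi_domain" "h \<in> {0..<1}" "parisi_distribution \<beta> \<nu> h = 1" "y h = 1" for y h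
    unfolding eq by (rule fo) (use that eq in auto)
qed

section \<open>Maximizers of the integrated first variation\<close>

lemma power_series_deriv:
  fixes f :: "real \<Rightarrow> real"
  assumes f: "\<And>x. \<bar>x\<bar> < r \<Longrightarrow> (\<lambda>n. c n * x ^ n) sums f x" and x: "\<bar>x\<bar> < r"
  shows "(f has_real_derivative deriv f x) (at x)"
    and "(\<lambda>n. diffs c n * x ^ n) sums deriv f x"
proof -
  have "((\<lambda>x. \<Sum>n. c n * x ^ n) has_real_derivative (\<Sum>n. diffs c n * x ^ n)) (at x)"
    using f x by (intro termdiffs_strong'[of r]) (auto simp: sums_iff)
  then have D: "(f has_real_derivative (\<Sum>n. diffs c n * x ^ n)) (at x)"
    by (rule has_field_derivative_transform_within_open[where S="{-r<..<r}"])
       (use f x in \<open>auto simp: sums_iff abs_less_iff\<close>)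
  then have eq: "deriv f x = (\<Sum>n. diffs c n * x ^ n)" by (rule DERIV_imp_deriv)
  then show "(f has_real_derivative deriv f x) (at x)" using D by simp
  have "summable (\<lambda>n. diffs c n * x ^ n)"
    using f x by (intro termdiff_converges[of x r c]) (auto simp: sums_iff)
  then show "(\<lambda>n. diffs c n * x ^ n) sums deriv f x" by (simp add: eq summable_sums)
qed

text \<open>The radius of convergence exceeds 1, so [-1, 1] lies in the open interval of convergence
  and the derivatives at its ends are two-sided. Nonnegativity of the derivative at 0 settles the
  case of a maximizer at 0.\<close>

lemma mixture_derivs:
  assumes "mixture \<nu>" and x: "x \<in> {-1..1}"
  shows "(\<nu> has_real_derivative deriv \<nu> x) (at x)"
    and "(deriv \<nu> has_real_derivative deriv (deriv \<nu>) x) (at x)"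
    and "isCont (deriv (deriv \<nu>)) x"
    and "0 \<le> deriv \<nu> 0"
proof -
  obtain g :: "nat \<Rightarrow> real" and r where r: "r > 1"
    and \<nu>: "\<And>x. \<bar>x\<bar> < r \<Longrightarrow> (\<lambda>p. (g (Suc p))\<^sup>2 * x ^ Suc p) sums \<nu> x"
    using assms(1) by (auto simp: mixture_def)
  \<comment> \<open>The series of a mixture starts at exponent 1; a leading coefficient 0 makes it
    an ordinary power series.\<close>
  define c where "c n = (if n = 0 then 0 else (g n)\<^sup>2)" for n
  have 0: "(\<lambda>n. c n * x ^ n) sums \<nu> x" if "\<bar>x\<bar> < r" for x
    using \<nu>[OF that] sums_Suc[of "\<lambda>n. c n * x ^ n" "\<nu> x"] by (simp add: c_def)
  have 1: "(\<nu> has_real_derivative deriv \<nu> x) (at x)" "(\<lambda>n. diffs c n * x ^ n) sums deriv \<nu> x"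
    if "\<bar>x\<bar> < r" for x
    using power_series_deriv[OF 0 that] by simp_all
  \<comment> \<open>The derivative is again a power series on the same interval, so
    \<open>power_series_deriv\<close> can be iterated.\<close>
  have 2: "(deriv \<nu> has_real_derivative deriv (deriv \<nu>) x) (at x)"
    "(\<lambda>n. diffs (diffs c) n * x ^ n) sums deriv (deriv \<nu>) x" if "\<bar>x\<bar> < r" for x
    using power_series_deriv[OF 1(2) that] by simp_all
  have 3: "isCont (deriv (deriv \<nu>)) x" if "\<bar>x\<bar> < r" for x
    using DERIV_isCont[OF power_series_deriv(1)[OF 2(2) that]] by simp
  show "(\<nu> has_real_derivative deriv \<nu> x) (at x)"
    "(deriv \<nu> has_real_derivative deriv (deriv \<nu>) x) (at x)"
    "isCont (deriv (deriv \<nu>)) x"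
    using 1(1)[of x] 2(1)[of x] 3[of x] x r by auto
  have "deriv \<nu> 0 = diffs c 0"
    using 1(2)[of 0] r powser_sums_zero_iff[of "diffs c" "deriv \<nu> 0"] by simp
  then show "0 \<le> deriv \<nu> 0" by (simp add: diffs_def c_def)
qed

lemma mixture_continuous_on_deriv:
  assumes "mixture \<nu>"
  shows "continuous_on {0..1} (deriv \<nu>)" "continuous_on {0..1} (deriv (deriv \<nu>))"
  by (auto intro!: continuous_at_imp_continuous_on DERIV_isCont[OF mixture_derivs(2)[OF assms]]
      mixture_derivs(3)[OF assms])

text \<open>Integrability makes both parts finite, so the extended difference is the Lebesgue
  integral. This turns \<open>parisi_phi\<close> into an ordinary integral on [0, 1).\<close>

lemma ereal_lebesgue_integral_eq_nn_integral_diff: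
  fixes f :: "'a \<Rightarrow> real"
  assumes "set_integrable M A f"
  shows "enn2ereal (\<integral>\<^sup>+x\<in>A. ennreal (f x) \<partial>M) - enn2ereal (\<integral>\<^sup>+x\<in>A. ennreal (- f x) \<partial>M)
    = ereal (LINT x:A|M. f x)"
proof -
  let ?f = "\<lambda>x. indicat_real A x * f x"
  have i: "integrable M ?f" using assms by (simp add: set_integrable_def)
  have "(\<integral>\<^sup>+x\<in>A. ennreal (f x) \<partial>M) = (\<integral>\<^sup>+x. ennreal (?f x) \<partial>M)"
    "(\<integral>\<^sup>+x\<in>A. ennreal (- f x) \<partial>M) = (\<integral>\<^sup>+x. ennreal (- ?f x) \<partial>M)"
    by (auto intro!: nn_integral_cong simp: indicator_def)
  moreover have "(\<integral>\<^sup>+x. ennreal (?f x) \<partial>M) \<noteq> \<infinity>" "(\<integral>\<^sup>+x. ennreal (- ?f x) \<partial>M) \<noteq> \<infinity>"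
    using real_integrable_def[of M ?f] i by auto
  moreover have "enn2ereal a = ereal (enn2real a)" if "a \<noteq> \<infinity>" for a
    using that by (cases a) (auto simp: enn2ereal_ennreal)
  ultimately show ?thesis
    using real_lebesgue_integral_def[OF i] by (simp add: set_lebesgue_integral_def)
qed

section \<open>The function \<Phi> and the maximizers of its primitive\<close>

locale parisi =
  fixes \<nu> :: "real \<Rightarrow> real" and \<beta> :: real
  assumes mixture: "mixture \<nu>" and beta_pos: "\<beta> > 0"
begin

abbreviation "x\<^sub>\<beta> \<equiv> parisi_distribution \<beta> \<nu>"
abbreviation "\<Phi> \<equiv> parisi_Phi \<beta> \<nu>"

lemma Phi_eq_variation: "\<Phi> = first_variation (\<lambda>q. \<beta>\<^sup>2 * deriv \<nu> q) (tail_mass x\<^sub>\<beta>)"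
  by (simp add: fun_eq_iff parisi_Phi_def first_variation_def tail_mass_def)

lemma continuous_on_weight: "continuous_on {0..1} (\<lambda>q. \<beta>\<^sup>2 * deriv \<nu> q)"
  by (intro continuous_intros mixture_continuous_on_deriv mixture)

lemmas x_in_domain = parisi_distribution_first_order(1)[OF mixture_continuous_on_deriv(1)[OF mixture], of \<beta>]
lemmas first_order = parisi_distribution_first_order(2)
  [OF mixture_continuous_on_deriv(1)[OF mixture], of _ _ \<beta>, folded Phi_eq_variation]

lemma continuous_on_Phi: "h < 1 \<Longrightarrow> continuous_on {0..h} \<Phi>"
  unfolding Phi_eq_variation
  by (intro continuous_on_variation x_in_domain continuous_on_weight)

lemma set_integrable_Phi: "0 \<le> a \<Longrightarrow> b < 1 \<Longrightarrow> set_integrable lborel {a..b} \<Phi>"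
  by (intro borel_integrable_atLeastAtMost' continuous_on_subset[OF continuous_on_Phi]) auto

lemma Phi_eventually_le:
  obtains k where "k \<in> {0<..<1}" "\<And>t. t \<in> {k..<1} \<Longrightarrow> \<Phi> t \<le> - 1"
proof -
  let ?w = "\<lambda>q. \<beta>\<^sup>2 * deriv \<nu> q"
  have "bounded (?w ` {0..1})"
    using continuous_on_weight by (intro compact_imp_bounded compact_continuous_image) auto
  then obtain M where M: "\<And>t. t \<in> {0..1} \<Longrightarrow> \<bar>?w t\<bar> \<le> M"
    unfolding bounded_real by blast
  have M0: "0 \<le> M" using order_trans[OF abs_ge_zero M, of 0] by simp
  \<comment> \<open>At this point t/(1 - t) equals M + 1, so from there on \<Phi> is at most M - (M
    + 1).\<close>
  define k where "k = (M + 1) / (M + 2)"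
  have k: "k \<in> {0<..<1}" using M0 by (auto simp: k_def divide_simps)
  have "\<Phi> t \<le> - 1" if t: "t \<in> {k..<1}" for t
  proof -
    have "M + 1 \<le> t * (M + 2)" using t M0 by (simp add: k_def pos_divide_le_eq)
    then have "(M + 1) * (1 - t) \<le> t" by (simp add: algebra_simps)
    then have "M + 1 \<le> t / (1 - t)" using t by (simp add: pos_le_divide_eq)
    moreover have "?w t \<le> M" using order_trans[OF abs_ge_self M, of t] t k by auto
    ultimately show ?thesis
      using first_variation_le[OF x_in_domain, of t ?w] t k unfolding Phi_eq_variation by auto
  qed
  then show thesis using that k by blast
qed

lemma phi_eq: "0 \<le> s \<Longrightarrow> s < 1 \<Longrightarrow> parisi_phi \<beta> \<nu> s = ereal (LBINT t:{0..s}. \<Phi> t)"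
  unfolding parisi_phi_def
  by (intro ereal_lebesgue_integral_eq_nn_integral_diff set_integrable_Phi) auto

lemma S_le:
  assumes "q \<in> parisi_S \<beta> \<nu>" "s \<in> {0..1}"
  shows "parisi_phi \<beta> \<nu> s \<le> parisi_phi \<beta> \<nu> q"
  using assms by (auto simp: parisi_S_def intro: SUP_upper)

text \<open>The value minus infinity at 1 is never computed. As \<Phi> is negative on (s, 1),
  extending the integral from s to 1 leaves the positive part unchanged and cannot decrease the
  negative part; between k and s the integral already drops strictly.\<close>

lemma S_less_1:
  assumes q: "q \<in> parisi_S \<beta> \<nu>"
  shows "q \<in> {0..<1}"
proof -
  obtain k where k: "k \<in> {0<..<1}" "\<And>t. t \<in> {k..<1} \<Longrightarrow> \<Phi> t \<le> - 1"
    by (rule Phi_eventually_le) (rule that)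
  define s where "s = (1 + k) / 2"
  have s: "k < s" "s < 1" using k(1) by (auto simp: s_def)
  have "(\<integral>\<^sup>+t\<in>{0..1}. ennreal (\<Phi> t) \<partial>lborel) = (\<integral>\<^sup>+t\<in>{0..s}. ennreal (\<Phi> t) \<partial>lborel)"
  proof (rule nn_integral_cong_AE)
    have "AE t in lborel. t \<noteq> (1::real)" by (rule AE_lborel_singleton)
    then show "AE t in lborel. ennreal (\<Phi> t) * indicator {0..1} t = ennreal (\<Phi> t) * indicator {0..s} t"
    proof eventually_elim
      case (elim t)
      show ?case
      proof (cases "s < t \<and> t < 1")
        case True
        then show ?thesis using k(2)[of t] s by (simp add: ennreal_neg)
      qed (use elim s in \<open>auto simp: indicator_def\<close>)
    qed
  qed
  moreover have "(\<integral>\<^sup>+t\<in>{0..s}. ennreal (- \<Phi> t) \<partial>lborel) \<le> (\<integral>\<^sup>+t\<in>{0..1}. ennreal (- \<Phi> t) \<partial>lborel)"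
    using s by (intro nn_set_integral_set_mono) auto
  ultimately have "parisi_phi \<beta> \<nu> 1 \<le> parisi_phi \<beta> \<nu> s"
    unfolding parisi_phi_def by (intro ereal_minus_mono) (simp_all add: less_eq_ennreal.rep_eq)
  also have "(LBINT t:{0..s}. \<Phi> t) < (LBINT t:{0..k}. \<Phi> t)"
  proof -
    have "(LBINT t:{k..s}. \<Phi> t) \<le> (LBINT t:{k..s}. - 1)"
      using k s by (intro set_integral_mono set_integrable_Phi borel_integrable_atLeastAtMost') auto
    then have "(LBINT t:{k..s}. \<Phi> t) < 0" using s by (simp add: set_integral_const)
    then show ?thesis
      using set_integral_split[OF set_integrable_Phi, of 0 s k] k s by simp
  qed
  then have "parisi_phi \<beta> \<nu> s < parisi_phi \<beta> \<nu> k" using k s by (simp add: phi_eq)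
  also have "\<dots> \<le> parisi_phi \<beta> \<nu> q" using S_le[OF q, of k] k by simp
  finally have "q \<noteq> 1" by auto
  then show ?thesis using q by (auto simp: parisi_S_def)
qed

lemma S_integral_le:
  assumes q: "q \<in> parisi_S \<beta> \<nu>" and s: "s \<in> {0..<1}"
  shows "(LBINT t:{0..s}. \<Phi> t) \<le> (LBINT t:{0..q}. \<Phi> t)"
  using S_le[OF q, of s] S_less_1[OF q] s by (simp add: phi_eq)

lemma S_integral_nonneg:
  assumes q: "q \<in> parisi_S \<beta> \<nu>" and s: "s \<in> {0..q}"
  shows "0 \<le> (LBINT t:{s..q}. \<Phi> t)"
  using S_integral_le[OF q, of s] set_integral_split[OF set_integrable_Phi, of 0 q s] S_less_1[OF q] s
  by simp

text \<open>An interior maximizer is a critical point of the primitive of \<Phi>. At q = 0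
  maximality only excludes a positive value; a negative one is excluded because
  \<open>\<Phi> 0 = \<beta>\<^sup>2 * deriv \<nu> 0\<close> is nonnegative.\<close>

lemma S_Phi_eq_0:
  assumes q: "q \<in> parisi_S \<beta> \<nu>"
  shows "\<Phi> q = 0"
proof -
  note q1 = S_less_1[OF q]
  \<comment> \<open>Any point strictly between \<open>q\<close> and 1 serves: it leaves room to the
    right of \<open>q\<close>, and \<Phi> is continuous on [0, k].\<close>
  define k where "k = (1 + q) / 2"
  have k: "q < k" "k < 1" using q1 by (auto simp: k_def)
  let ?I = "\<lambda>s. integral {0..s} \<Phi>"
  have le: "?I s \<le> ?I q" if "s \<in> {0..k}" for s
    using S_integral_le[OF q, of s] that k q1
    by (simp add: set_borel_integral_eq_integral(2)[OF set_integrable_Phi])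
  have D: "(?I has_real_derivative \<Phi> q) (at q within {0..k})"
    using integral_has_real_derivative[OF continuous_on_Phi[OF k(2)], of q] q1 k by simp
  have "\<not> 0 < \<Phi> q"
  proof
    assume "0 < \<Phi> q"
    then obtain d where d: "d > 0" "\<And>h. 0 < h \<Longrightarrow> q + h \<in> {0..k} \<Longrightarrow> h < d \<Longrightarrow> ?I q < ?I (q + h)"
      using has_real_derivative_pos_inc_right[OF D] by blast
    define h where "h = min (d / 2) (k - q)"
    have "0 < h" "h < d" "q + h \<in> {0..k}" using d k q1 by (auto simp: h_def)
    then show False using d(2)[of h] le[of "q + h"] by auto
  qed
  moreover have "\<not> \<Phi> q < 0"
  proof
    assume neg: "\<Phi> q < 0"
    then obtain d where d: "d > 0" "\<And>h. 0 < h \<Longrightarrow> q - h \<in> {0..k} \<Longrightarrow> h < d \<Longrightarrow> ?I q < ?I (q - h)"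
      using has_real_derivative_neg_dec_left[OF D] by blast
    have "\<Phi> 0 = \<beta>\<^sup>2 * deriv \<nu> 0"
      unfolding parisi_Phi_def set_integral_half_open[symmetric, of 0 0]
      by (simp add: set_lebesgue_integral_def)
    then have "0 \<le> \<Phi> 0" using mixture_derivs(4)[OF mixture, of 0] by simp
    then have "q \<noteq> 0" using neg by auto
    define h where "h = min (d / 2) q"
    have "0 < h" "h < d" "q - h \<in> {0..k}" using d k q1 \<open>q \<noteq> 0\<close> by (auto simp: h_def)
    then show False using d(2)[of h] le[of "q - h"] by auto
  qed
  ultimately show ?thesis by linarith
qed

end

section \<open>The mixture to the right of a maximizer\<close>

lemma continuous_at_right_affine:
  fixes f :: "real \<Rightarrow> real"
  assumes "c > 0" "continuous (at_right (a + c * t)) f"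
  shows "continuous (at_right t) (\<lambda>s. f (a + c * s))"
proof (rule continuous_within_compose2[where g=f and f="\<lambda>s. a + c * s"])
  show "continuous (at (a + c * t) within (\<lambda>s. a + c * s) ` {t<..}) f"
    by (rule continuous_within_subset[OF assms(2)]) (use \<open>c > 0\<close> in auto)
qed (intro continuous_intros)

definition restrict_right :: "real \<Rightarrow> (real \<Rightarrow> real) \<Rightarrow> real \<Rightarrow> real" where
  "restrict_right q x = (\<lambda>t\<in>{0..1}. x (q + (1 - q) * t))"

text \<open>Carries a competitor for the right mixture back to one for \<nu>. The value 0 before
  \<open>q\<close> is the least possible; testing with it bounds the integral of \<Phi> times
  \<open>x\<^sub>\<beta>\<close> over [0, q] from above.\<close>

definition extend_left :: "real \<Rightarrow> (real \<Rightarrow> real) \<Rightarrow> real \<Rightarrow> real" where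
  "extend_left q z = (\<lambda>u\<in>{0..1}. if u < q then 0 else z ((u - q) / (1 - q)))"

lemma affine_in_unit_interval:
  fixes q t :: real
  assumes "0 \<le> q" "q < 1" "0 \<le> t" "t \<le> 1"
  shows "q \<le> q + (1 - q) * t" "q + (1 - q) * t \<le> 1" "t < 1 \<Longrightarrow> q + (1 - q) * t < 1"
    "t \<le> q + (1 - q) * t"
proof -
  have "(1 - q) * t \<le> (1 - q) * 1" using assms by (intro mult_left_mono) auto
  then show "q + (1 - q) * t \<le> 1" by simp
  have "(1 - q) * t < (1 - q) * 1" if "t < 1" using assms that by (intro mult_strict_left_mono) auto
  then show "q + (1 - q) * t < 1" if "t < 1" using that by simp
  have "q * t \<le> q * 1" using assms by (intro mult_left_mono) auto
  then show "t \<le> q + (1 - q) * t" by (simp add: algebra_simps)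
qed (use assms in auto)

lemma restrict_right_in_parisi_domain:
  assumes x: "x \<in> parisi_domain" and q: "q \<in> {0..<1}"
  shows "restrict_right q x \<in> parisi_domain"
proof -
  note aff = affine_in_unit_interval[of q]
  obtain h where h: "h \<in> {0..<1}" "x h = 1" using parisi_domainD(6)[OF x] by blast
  have "restrict_right q x h = 1"
    using parisi_domain_eq_1[OF x _ h(2), of "q + (1 - q) * h"] h q aff[of h]
    by (auto simp: restrict_right_def)
  moreover have "continuous (at_right t) (restrict_right q x)" if t: "t \<in> {0..<1}" for t
  proof (rule continuous_at_right_cong[where b=1])
    show "continuous (at_right t) (\<lambda>t. x (q + (1 - q) * t))"
      using q t aff[of t] by (intro continuous_at_right_affine parisi_domainD(4)[OF x]) auto
  qed (use t in \<open>auto simp: restrict_right_def\<close>)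
  moreover have "mono_on {0..1} (restrict_right q x)"
  proof (rule mono_onI)
    fix s t :: real assume st: "s \<in> {0..1}" "t \<in> {0..1}" "s \<le> t"
    have "q + (1 - q) * s \<le> q + (1 - q) * t" using st q by (intro add_left_mono mult_left_mono) auto
    then show "restrict_right q x s \<le> restrict_right q x t"
      using st q aff[of s] aff[of t] mono_onD[OF parisi_domainD(1)[OF x], of "q + (1 - q) * s" "q + (1 - q) * t"]
      by (auto simp: restrict_right_def)
  qed
  moreover have "restrict_right q x t \<in> {0..1}" if "t \<in> {0..1}" for t
    using that q aff[of t] parisi_domainD(2,3)[OF x, of "q + (1 - q) * t"]
    by (auto simp: restrict_right_def)
  ultimately show ?thesis
    using h by (auto simp: parisi_domain_def restrict_right_def)
qed

lemma extend_left_affine: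
  assumes "q \<in> {0..<1}" "t \<in> {0..1}"
  shows "extend_left q z (q + (1 - q) * t) = z t"
  using assms affine_in_unit_interval[of q t] by (auto simp: extend_left_def mult_less_0_iff)

lemma extend_left_in_parisi_domain:
  assumes z: "z \<in> parisi_domain" and q: "q \<in> {0..<1}"
  shows "extend_left q z \<in> parisi_domain"
proof -
  have r: "(u - q) / (1 - q) \<in> {0..1}" "u < 1 \<Longrightarrow> (u - q) / (1 - q) < 1" if "q \<le> u" "u \<le> 1" for u
    using that q by (auto simp: divide_simps)
  obtain h where h: "h \<in> {0..<1}" "z h = 1" using parisi_domainD(6)[OF z] by blast
  have "extend_left q z (q + (1 - q) * h) = 1" "q + (1 - q) * h \<in> {0..<1}"
    using extend_left_affine[OF q, of h] affine_in_unit_interval[of q h] h q by auto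
  moreover have "continuous (at_right t) (extend_left q z)" if t: "t \<in> {0..<1}" for t
  proof (cases "t < q")
    case True
    show ?thesis
      by (rule continuous_at_right_cong[OF continuous_const[of _ 0] True])
         (use t q in \<open>auto simp: extend_left_def\<close>)
  next
    case False
    have eq: "(u - q) / (1 - q) = (- q / (1 - q)) + (1 / (1 - q)) * u" for u
      by (simp add: diff_divide_distrib)
    show ?thesis
    proof (rule continuous_at_right_cong[where b=1])
      show "continuous (at_right t) (\<lambda>u. z ((- q / (1 - q)) + (1 / (1 - q)) * u))"
        using r[of t] q t False unfolding eq
        by (intro continuous_at_right_affine parisi_domainD(4)[OF z]) auto
    qed (use t q False in \<open>auto simp: extend_left_def eq\<close>)
  qed
  moreover have "mono_on {0..1} (extend_left q z)"
  proof (rule mono_onI)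
    fix s t :: real assume st: "s \<in> {0..1}" "t \<in> {0..1}" "s \<le> t"
    have "(s - q) / (1 - q) \<le> (t - q) / (1 - q)" using st q by (intro divide_right_mono) auto
    then show "extend_left q z s \<le> extend_left q z t"
      using st r[of s] r[of t] parisi_domainD(2)[OF z, of "(t - q) / (1 - q)"]
        mono_onD[OF parisi_domainD(1)[OF z], of "(s - q) / (1 - q)" "(t - q) / (1 - q)"]
      by (auto simp: extend_left_def)
  qed
  moreover have "extend_left q z t \<in> {0..1}" if "t \<in> {0..1}" for t
    using that r[of t] parisi_domainD(2,3)[OF z, of "(t - q) / (1 - q)"]
    by (auto simp: extend_left_def)
  moreover have "extend_left q z \<in> extensional {0..1}" by (simp add: extend_left_def)
  ultimately show ?thesis
    by (auto simp: parisi_domain_def PiE_def intro!: bexI[of _ "q + (1 - q) * h"])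
qed

lemma deriv_right_mixture:
  assumes "mixture \<nu>" "q \<in> {0..<1}" "t \<in> {0..1}"
  shows "deriv (right_mixture \<nu> q) t = (1 - q) * (deriv \<nu> (q + (1 - q) * t) - deriv \<nu> q)"
proof (rule DERIV_imp_deriv)
  have "(\<nu> has_real_derivative deriv \<nu> ((1 - q) * t + q)) (at ((1 - q) * t + q))"
    using affine_in_unit_interval[of q t] assms by (intro mixture_derivs(1)) auto
  then have "((\<lambda>t. \<nu> ((1 - q) * t + q)) has_real_derivative deriv \<nu> ((1 - q) * t + q) * (1 - q)) (at t)"
    by (rule DERIV_chain2) (auto intro!: derivative_eq_intros)
  then show "(right_mixture \<nu> q has_real_derivative
      (1 - q) * (deriv \<nu> (q + (1 - q) * t) - deriv \<nu> q)) (at t)"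
    unfolding right_mixture_def[abs_def]
    by (auto intro!: derivative_eq_intros simp: algebra_simps)
qed

lemma tail_mass_restrict_right:
  assumes "q \<in> {0..<1}" "s \<in> {0..1}"
  shows "tail_mass x (q + (1 - q) * s) = (1 - q) * tail_mass (restrict_right q x) s"
proof -
  have "tail_mass x (q + (1 - q) * s) = (LBINT u:{q + (1 - q) * s..q + (1 - q) * 1}. x u)"
    by (simp add: tail_mass_def)
  also have "\<dots> = (1 - q) * (LBINT t:{s..1}. x (q + (1 - q) * t))"
    using assms by (intro set_integral_affine) auto
  also have "(LBINT t:{s..1}. x (q + (1 - q) * t)) = tail_mass (restrict_right q x) s"
    unfolding tail_mass_def using assms by (intro set_lebesgue_integral_cong) (auto simp: restrict_right_def)
  finally show ?thesis .
qed

context parisi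
begin

text \<open>This is the first order condition at \<open>x\<^sub>\<beta>\<close> tested with
  \<open>extend_left q z\<close>: on [0, q) the competitor is 0 and leaves minus the integral of
  \<Phi> times \<open>x\<^sub>\<beta>\<close>, while the part on [q, k] is rescaled.\<close>

lemma integral_S_extend_left:
  assumes q: "q \<in> parisi_S \<beta> \<nu>" and h: "h \<in> {0<..<1}" "z h = 1" "x\<^sub>\<beta> (q + (1 - q) * h) = 1"
    and z: "z \<in> parisi_domain"
  shows "(LBINT t:{0..q}. \<Phi> t * x\<^sub>\<beta> t) \<le>
    (1 - q) * (LBINT s:{0..h}. \<Phi> (q + (1 - q) * s) * (z s - x\<^sub>\<beta> (q + (1 - q) * s)))"
proof -
  note q1 = S_less_1[OF q]
  define k where "k = q + (1 - q) * h"
  have k: "k \<in> {0..<1}" "q \<le> k" using affine_in_unit_interval[of q h] q1 h by (auto simp: k_def)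
  define y where "y = extend_left q z"
  have y: "y \<in> parisi_domain" unfolding y_def by (rule extend_left_in_parisi_domain[OF z q1])
  have yk: "y k = 1" using extend_left_affine[OF q1, of h z] h by (simp add: y_def k_def)
  have int: "set_integrable lborel {0..k} (\<lambda>s. (y s - x\<^sub>\<beta> s) * \<Phi> s)"
    using k by (intro set_integrable_mult_continuous_on continuous_on_Phi set_integral_diff
        set_integrable_parisi_domain y x_in_domain) auto
  have "0 \<le> (LBINT s:{0..k}. \<Phi> s * (y s - x\<^sub>\<beta> s))"
    using h k yk by (intro first_order y) (auto simp: k_def)
  also have "\<dots> = (LBINT s:{0..q}. \<Phi> s * (y s - x\<^sub>\<beta> s)) + (LBINT s:{q..k}. \<Phi> s * (y s - x\<^sub>\<beta> s))"
    using int k q1 by (intro set_integral_split) (auto simp: mult.commute)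
  \<comment> \<open>At \<open>q\<close> itself the extension takes the value \<open>z 0\<close>,
    hence the passage to [0, q).\<close>
  also have "(LBINT s:{0..q}. \<Phi> s * (y s - x\<^sub>\<beta> s)) = (LBINT s:{0..<q}. - (\<Phi> s * x\<^sub>\<beta> s))"
    unfolding set_integral_half_open[symmetric]
    using q1 by (intro set_lebesgue_integral_cong) (auto simp: y_def extend_left_def)
  also have "\<dots> = - (LBINT s:{0..q}. \<Phi> s * x\<^sub>\<beta> s)"
    unfolding set_integral_half_open by (simp add: set_lebesgue_integral_def)
  also have "(LBINT s:{q..k}. \<Phi> s * (y s - x\<^sub>\<beta> s)) =
      (LBINT s:{q + (1 - q) * 0..q + (1 - q) * h}. \<Phi> s * (y s - x\<^sub>\<beta> s))"
    by (simp add: k_def)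
  also have "\<dots> = (1 - q) * (LBINT s:{0..h}. \<Phi> (q + (1 - q) * s) *
      (y (q + (1 - q) * s) - x\<^sub>\<beta> (q + (1 - q) * s)))"
    using q1 by (intro set_integral_affine) auto
  also have "(LBINT s:{0..h}. \<Phi> (q + (1 - q) * s) * (y (q + (1 - q) * s) - x\<^sub>\<beta> (q + (1 - q) * s))) =
      (LBINT s:{0..h}. \<Phi> (q + (1 - q) * s) * (z s - x\<^sub>\<beta> (q + (1 - q) * s)))"
    using h by (intro set_lebesgue_integral_cong) (auto simp: y_def extend_left_affine[OF q1])
  finally show ?thesis by linarith
qed

text \<open>For the upper bound the competitor extends the restriction of
  \<open>x\<^sub>\<beta>\<close> itself, so the right side of \<open>integral_S_extend_left\<close>
  vanishes. The lower bound is the second mean value argument, since \<Phi> has nonnegative integral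
  over every [s, q].\<close>

lemma integral_S_x_eq_0:
  assumes q: "q \<in> parisi_S \<beta> \<nu>"
  shows "(LBINT t:{0..q}. \<Phi> t * x\<^sub>\<beta> t) = 0"
proof (rule antisym)
  note q1 = S_less_1[OF q]
  obtain h where h: "h \<in> {0<..<1}" "x\<^sub>\<beta> h = 1"
    using parisi_domain_common_cutoff[OF x_in_domain x_in_domain] by blast
  have xk: "x\<^sub>\<beta> (q + (1 - q) * h) = 1"
    using parisi_domain_eq_1[OF x_in_domain _ h(2), of "q + (1 - q) * h"]
      affine_in_unit_interval[of q h] h q1 by auto
  have "(LBINT t:{0..q}. \<Phi> t * x\<^sub>\<beta> t) \<le> (1 - q) * (LBINT s:{0..h}. \<Phi> (q + (1 - q) * s) *
      (restrict_right q x\<^sub>\<beta> s - x\<^sub>\<beta> (q + (1 - q) * s)))"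
    using h xk by (intro integral_S_extend_left q restrict_right_in_parisi_domain x_in_domain q1)
      (auto simp: restrict_right_def)
  also have "(LBINT s:{0..h}. \<Phi> (q + (1 - q) * s) *
      (restrict_right q x\<^sub>\<beta> s - x\<^sub>\<beta> (q + (1 - q) * s))) = (LBINT s:{0..h}. 0)"
    using h by (intro set_lebesgue_integral_cong) (auto simp: restrict_right_def)
  finally show "(LBINT t:{0..q}. \<Phi> t * x\<^sub>\<beta> t) \<le> 0" by simp
  show "0 \<le> (LBINT t:{0..q}. \<Phi> t * x\<^sub>\<beta> t)"
    using q1 parisi_domainD(1,2)[OF x_in_domain]
    by (intro set_integral_mult_mono_on_nonneg set_integrable_Phi S_integral_nonneg q)
       (auto intro: mono_on_subset)
qed

text \<open>By \<open>\<Phi> q = 0\<close>, \<beta>^2 times the derivative of \<nu> at q equals the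
  integral of the inverse squared tail mass over [0, q]. The linear term subtracted in
  \<open>right_mixture\<close> therefore cancels exactly this part; the factor 1 - q comes from the
  substitution and the scaling of the tail mass.\<close>

lemma first_variation_right_mixture:
  assumes q: "q \<in> parisi_S \<beta> \<nu>" and t: "t \<in> {0..<1}"
  shows "first_variation (\<lambda>s. \<beta>\<^sup>2 * deriv (right_mixture \<nu> q) s) (tail_mass (restrict_right q x\<^sub>\<beta>)) t
    = (1 - q) * \<Phi> (q + (1 - q) * t)"
proof -
  note q1 = S_less_1[OF q]
  define G where "G a b = (LBINT s:{a..b}. 1 / (tail_mass x\<^sub>\<beta> s)\<^sup>2)" for a b
  define u where "u = q + (1 - q) * t"
  have u: "q \<le> u" "u < 1" using affine_in_unit_interval[of q t] q1 t by (auto simp: u_def)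
  have "G q u = G (q + (1 - q) * 0) (q + (1 - q) * t)" by (simp add: u_def)
  also have "\<dots> = (1 - q) * (LBINT s:{0..t}. 1 / (tail_mass x\<^sub>\<beta> (q + (1 - q) * s))\<^sup>2)"
    unfolding G_def using q1 by (intro set_integral_affine) auto
  also have "(LBINT s:{0..t}. 1 / (tail_mass x\<^sub>\<beta> (q + (1 - q) * s))\<^sup>2) =
      (LBINT s:{0..t}. 1 / (1 - q)\<^sup>2 * (1 / (tail_mass (restrict_right q x\<^sub>\<beta>) s)\<^sup>2))"
    using q1 t by (intro set_lebesgue_integral_cong) (auto simp: tail_mass_restrict_right power_mult_distrib)
  also have "\<dots> = 1 / (1 - q)\<^sup>2 * (LBINT s:{0..t}. 1 / (tail_mass (restrict_right q x\<^sub>\<beta>) s)\<^sup>2)"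
    by (rule set_integral_mult_right)
  finally have "(LBINT s:{0..t}. 1 / (tail_mass (restrict_right q x\<^sub>\<beta>) s)\<^sup>2) = (1 - q) * G q u"
    using q1 by (simp add: power2_eq_square)
  moreover have "G 0 u = G 0 q + G q u"
    unfolding G_def using q1 u
    by (intro set_integral_split borel_integrable_atLeastAtMost'
        continuous_on_inverse_square_tail_mass x_in_domain) auto
  moreover have "\<beta>\<^sup>2 * deriv \<nu> q = G 0 q"
    using S_Phi_eq_0[OF q] by (simp add: Phi_eq_variation first_variation_def G_def)
  moreover have "\<beta>\<^sup>2 * deriv (right_mixture \<nu> q) t = (1 - q) * (\<beta>\<^sup>2 * deriv \<nu> u - \<beta>\<^sup>2 * deriv \<nu> q)"
    using t by (subst deriv_right_mixture[OF mixture q1]) (auto simp: u_def algebra_simps)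
  moreover have "\<Phi> u = \<beta>\<^sup>2 * deriv \<nu> u - G 0 u"
    by (simp add: Phi_eq_variation first_variation_def G_def)
  ultimately show ?thesis
    unfolding first_variation_def u_def[symmetric] by (simp add: right_diff_distrib distrib_left)
qed

text \<open>By \<open>integral_S_x_eq_0\<close> the left side of
  \<open>integral_S_extend_left\<close> is 0, and what remains is, up to a positive factor, the
  first order condition for the right mixture at the restricted function.\<close>

lemma parisi_distribution_right_mixture:
  assumes q: "q \<in> parisi_S \<beta> \<nu>"
  shows "parisi_distribution \<beta> (right_mixture \<nu> q) = restrict_right q x\<^sub>\<beta>"
proof (rule parisi_distribution_eqI)
  note q1 = S_less_1[OF q]
  show "restrict_right q x\<^sub>\<beta> \<in> parisi_domain"
    by (intro restrict_right_in_parisi_domain x_in_domain q1)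
  have "continuous_on {0..1} (\<lambda>t. (1 - q) * (deriv \<nu> (q + (1 - q) * t) - deriv \<nu> q))"
    using affine_in_unit_interval[of q] q1
    by (intro continuous_intros continuous_on_compose2[OF mixture_continuous_on_deriv(1)[OF mixture]]) auto
  then show "continuous_on {0..1} (deriv (right_mixture \<nu> q))"
    by (rule continuous_on_cong[THEN iffD1, rotated 2])
       (use deriv_right_mixture[OF mixture q1] in auto)
  fix z h assume z: "z \<in> parisi_domain" and h: "h \<in> {0<..<1}" "restrict_right q x\<^sub>\<beta> h = 1" "z h = 1"
  have "0 \<le> (1 - q) * (LBINT s:{0..h}. \<Phi> (q + (1 - q) * s) * (z s - x\<^sub>\<beta> (q + (1 - q) * s)))"
    using integral_S_extend_left[OF q h(1,3) _ z] integral_S_x_eq_0[OF q] h(1,2)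
    by (auto simp: restrict_right_def)
  also have "\<dots> = (LBINT s:{0..h}. (1 - q) * (\<Phi> (q + (1 - q) * s) * (z s - x\<^sub>\<beta> (q + (1 - q) * s))))"
    by (rule set_integral_mult_right[symmetric])
  also have "\<dots> = (LBINT s:{0..h}. first_variation (\<lambda>s. \<beta>\<^sup>2 * deriv (right_mixture \<nu> q) s)
      (tail_mass (restrict_right q x\<^sub>\<beta>)) s * (z s - restrict_right q x\<^sub>\<beta> s))"
  proof (intro set_lebesgue_integral_cong allI impI)
    fix s assume "s \<in> {0..h}"
    then have s: "s \<in> {0..<1}" "s \<in> {0..1}" using h(1) by auto
    show "(1 - q) * (\<Phi> (q + (1 - q) * s) * (z s - x\<^sub>\<beta> (q + (1 - q) * s))) =
        first_variation (\<lambda>s. \<beta>\<^sup>2 * deriv (right_mixture \<nu> q) s) (tail_mass (restrict_right q x\<^sub>\<beta>)) s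
          * (z s - restrict_right q x\<^sub>\<beta> s)"
      unfolding first_variation_right_mixture[OF q s(1)] using s(2) by (simp add: restrict_right_def)
  qed simp
  finally show "0 \<le> (LBINT s:{0..h}. first_variation (\<lambda>s. \<beta>\<^sup>2 * deriv (right_mixture \<nu> q) s)
      (tail_mass (restrict_right q x\<^sub>\<beta>)) s * (z s - restrict_right q x\<^sub>\<beta> s))" .
qed

end

section \<open>The mixture to the left of a maximizer\<close>

lemma zero_temp_domainD:
  assumes "(\<alpha>, c) \<in> zero_temp_domain"
  shows "mono_on {0..<1} \<alpha>" "\<And>t. t \<in> {0..<1} \<Longrightarrow> 0 \<le> \<alpha> t"
    "\<And>t. t \<in> {0..<1} \<Longrightarrow> continuous (at_right t) \<alpha>"
    "\<alpha> \<in> extensional {0..<1}" "set_integrable lborel {0..1} \<alpha>" "0 < c"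
  using assms by (auto simp: zero_temp_domain_def PiE_def Pi_def set_integrable_half_open)

text \<open>Fubini and the fundamental theorem of calculus remove the second derivative, and its
  boundary term at 1 cancels against the integral of \<alpha> in the first term. The result has the
  shape of \<open>energy\<close>.\<close>

lemma zero_temp_functional_eq:
  assumes \<alpha>: "set_integrable lborel {0..1} \<alpha>"
    and D: "\<And>t. t \<in> {0..1} \<Longrightarrow> (deriv \<nu> has_real_derivative deriv (deriv \<nu>) t) (at t)"
    and c2: "continuous_on {0..1} (deriv (deriv \<nu>))"
  shows "zero_temp_functional \<alpha> c \<nu> = 1 / 2 * ((LBINT s:{0..1}. \<alpha> s * deriv \<nu> s) + deriv \<nu> 1 * c
    + (LBINT q:{0..1}. 1 / ((LBINT s:{q..1}. \<alpha> s) + c)))"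
proof -
  have c1: "continuous_on {0..1} (deriv \<nu>)"
    using DERIV_isCont[OF D] by (intro continuous_at_imp_continuous_on) auto
  have "(LBINT q:{0..1}. deriv (deriv \<nu>) q * (LBINT s:{0..q}. \<alpha> s)) =
      (LBINT s:{0..1}. \<alpha> s * (LBINT q:{s..1}. deriv (deriv \<nu>) q))"
    by (intro set_integral_triangle[symmetric] borel_integrable_atLeastAtMost'[OF c2] \<alpha>)
  also have "\<dots> = (LBINT s:{0..1}. deriv \<nu> 1 * \<alpha> s - \<alpha> s * deriv \<nu> s)"
  proof (intro set_lebesgue_integral_cong allI impI)
    fix s :: real assume s: "s \<in> {0..1}"
    have FTC: "(LBINT q:{s..1}. deriv (deriv \<nu>) q) = deriv \<nu> 1 - deriv \<nu> s"
      unfolding set_lebesgue_integral_def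
    proof (rule integral_FTC_Icc)
      show "(deriv \<nu> has_vector_derivative deriv (deriv \<nu>) x) (at x within {s..1})"
        if "s \<le> x" "x \<le> 1" for x
        using has_field_derivative_at_within[OF D[of x]] that s
        by (simp add: has_real_derivative_iff_has_vector_derivative)
    qed (use s in \<open>auto intro: continuous_on_subset[OF c2]\<close>)
    show "\<alpha> s * (LBINT q:{s..1}. deriv (deriv \<nu>) q) = deriv \<nu> 1 * \<alpha> s - \<alpha> s * deriv \<nu> s"
      unfolding FTC by (simp add: algebra_simps)
  qed simp
  also have "\<dots> = (LBINT s:{0..1}. deriv \<nu> 1 * \<alpha> s) - (LBINT s:{0..1}. \<alpha> s * deriv \<nu> s)"
    using \<alpha> by (intro set_integral_diff(2) set_integrable_mult_continuous_on[OF \<alpha> c1]) auto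
  finally have eq: "(LBINT q:{0..1}. deriv (deriv \<nu>) q * (LBINT s:{0..q}. \<alpha> s)) =
      (LBINT s:{0..1}. deriv \<nu> 1 * \<alpha> s) - (LBINT s:{0..1}. \<alpha> s * deriv \<nu> s)" .
  show ?thesis
    unfolding zero_temp_functional_def set_integral_half_open eq set_integral_mult_right
    by (simp add: distrib_left)
qed

text \<open>As at positive temperature, except for an extra term, \<open>e - c\<close> times the
  first variation at 1, which \<open>end_point\<close> removes. Equality of the functionals makes
  \<open>Y\<close> and \<open>X\<close> agree; at 1 this gives \<open>e = c\<close>, and right
  continuity then gives \<open>a = \<alpha>\<close>.\<close>

lemma zero_temp_minimizer_eqI:
  assumes dom: "(\<alpha>, c) \<in> zero_temp_domain"
    and D: "\<And>t. t \<in> {0..1} \<Longrightarrow> (deriv \<nu> has_real_derivative deriv (deriv \<nu>) t) (at t)"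
    and c2: "continuous_on {0..1} (deriv (deriv \<nu>))"
    and \<Psi>: "\<And>t. t \<in> {0..1} \<Longrightarrow> first_variation (deriv \<nu>) (\<lambda>q. (LBINT s:{q..1}. \<alpha> s) + c) t = \<Psi> t"
    and end_point: "\<Psi> 1 = 0"
    and first_order: "\<And>\<alpha>' c'. (\<alpha>', c') \<in> zero_temp_domain \<Longrightarrow> 0 \<le> (LBINT s:{0..1}. \<Psi> s * (\<alpha>' s - \<alpha> s))"
  shows "zero_temp_minimizer \<nu> = (\<alpha>, c)"
proof -
  define X where "X q = (LBINT s:{q..1}. \<alpha> s) + c" for q
  define G where "G s = (LBINT q:{0..s}. 1 / (X q)\<^sup>2)" for s
  have c1: "continuous_on {0..1} (deriv \<nu>)"
    using DERIV_isCont[OF D] by (intro continuous_at_imp_continuous_on) auto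
  note \<alpha> = zero_temp_domainD[OF dom]
  have tail_nonneg: "0 \<le> (LBINT s:{q..1}. a s)" if "(a, e) \<in> zero_temp_domain" "0 \<le> q" for a e and q :: real
    unfolding set_integral_half_open[symmetric] unfolding set_lebesgue_integral_def
    using zero_temp_domainD(2)[OF that(1)] that(2)
    by (intro Bochner_Integration.integral_nonneg) (auto simp: indicator_def)
  have X: "continuous_on {0..1} X"
    unfolding X_def by (intro continuous_intros continuous_on_upper_integral \<alpha>)
  have Xpos: "0 < X q" if "q \<in> {0..1}" for q
    using tail_nonneg[OF dom, of q] \<alpha>(6) that by (auto simp: X_def)
  have G: "continuous_on {0..1} G"
    unfolding G_def using Xpos
    by (intro continuous_on_lower_integral borel_integrable_atLeastAtMost' continuous_on_divide
        continuous_on_const continuous_on_power X) (auto simp: less_le)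
  have \<Psi>_eq: "\<Psi> t = deriv \<nu> t - G t" if "t \<in> {0..1}" for t
    using \<Psi>[OF that] by (simp add: first_variation_def G_def X_def)
  have *: "zero_temp_functional \<alpha> c \<nu> \<le> zero_temp_functional a e \<nu> \<and>
      (zero_temp_functional \<alpha> c \<nu> = zero_temp_functional a e \<nu> \<longrightarrow> a = \<alpha> \<and> e = c)"
    if ae: "(a, e) \<in> zero_temp_domain" for a e
  proof -
    note a = zero_temp_domainD[OF ae]
    define Y where "Y q = (LBINT s:{q..1}. a s) + e" for q
    have Ypos: "0 < Y q" if "q \<in> {0..1}" for q
      using tail_nonneg[OF ae, of q] a(6) that by (auto simp: Y_def)
    have d: "set_integrable lborel {0..1} (\<lambda>s. a s - \<alpha> s)"
      using a(5) \<alpha>(5) by (intro set_integral_diff)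
    have Y: "Y q = X q + (LBINT s:{q..1}. a s - \<alpha> s) + (e - c)" if q: "q \<in> {0..1}" for q
    proof -
      have "(LBINT s:{q..1}. a s - \<alpha> s) = (LBINT s:{q..1}. a s) - (LBINT s:{q..1}. \<alpha> s)"
        using q by (intro set_integral_diff set_integrable_subset[OF a(5)] set_integrable_subset[OF \<alpha>(5)]) auto
      then show ?thesis by (simp add: X_def Y_def)
    qed
    let ?R = "LBINT q:{0..1}. (Y q - X q)\<^sup>2 / ((X q)\<^sup>2 * Y q)"
    have exp: "(LBINT q:{0..1}. 1 / Y q) = (LBINT q:{0..1}. 1 / X q)
        - (LBINT s:{0..1}. (a s - \<alpha> s) * G s) - (e - c) * G 1 + ?R" "continuous_on {0..1} Y"
      unfolding G_def by (rule integral_inverse_expansion[OF d X Xpos Ypos Y]; assumption)+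
    have "(LBINT s:{0..1}. \<Psi> s * (a s - \<alpha> s)) = (LBINT s:{0..1}. (a s - \<alpha> s) * deriv \<nu> s - (a s - \<alpha> s) * G s)"
      by (intro set_lebesgue_integral_cong) (auto simp: \<Psi>_eq algebra_simps)
    also have "\<dots> = (LBINT s:{0..1}. (a s - \<alpha> s) * deriv \<nu> s) - (LBINT s:{0..1}. (a s - \<alpha> s) * G s)"
      by (intro set_integral_diff set_integrable_mult_continuous_on d c1 G)
    also have "(LBINT s:{0..1}. (a s - \<alpha> s) * deriv \<nu> s) =
        (LBINT s:{0..1}. a s * deriv \<nu> s) - (LBINT s:{0..1}. \<alpha> s * deriv \<nu> s)"
      unfolding left_diff_distrib
      by (intro set_integral_diff set_integrable_mult_continuous_on a \<alpha> c1)
    finally have lin: "(LBINT s:{0..1}. \<Psi> s * (a s - \<alpha> s)) =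
      (LBINT s:{0..1}. a s * deriv \<nu> s) - (LBINT s:{0..1}. \<alpha> s * deriv \<nu> s)
      - (LBINT s:{0..1}. (a s - \<alpha> s) * G s)" .
    have end_eq: "deriv \<nu> 1 = G 1"
      using \<Psi>_eq[of 1] end_point by simp
    have F: "zero_temp_functional \<alpha> c \<nu> = 1 / 2 * ((LBINT s:{0..1}. \<alpha> s * deriv \<nu> s) + deriv \<nu> 1 * c
        + (LBINT q:{0..1}. 1 / X q))"
      "zero_temp_functional a e \<nu> = 1 / 2 * ((LBINT s:{0..1}. a s * deriv \<nu> s) + deriv \<nu> 1 * e
        + (LBINT q:{0..1}. 1 / Y q))"
      unfolding X_def Y_def by (intro zero_temp_functional_eq \<alpha> a D c2; assumption)+
    have diff: "2 * (zero_temp_functional a e \<nu> - zero_temp_functional \<alpha> c \<nu>) =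
        (LBINT s:{0..1}. \<Psi> s * (a s - \<alpha> s)) + ?R"
    proof -
      \<comment> \<open>Both \<open>deriv \<nu> 1\<close> and \<open>G 1\<close> are instances of
        \<open>g\<close>; their equality makes the terms in \<open>e\<close> and \<open>c\<close>
        cancel.\<close>
      have "2 * (1 / 2 * (A + g * e + U) - 1 / 2 * (B + g * c + V)) = A - B - W + R"
        if "U = V - W - (e - c) * g + R" for A B U V W R g :: real
        unfolding that by (simp add: field_simps)
      from this[OF exp(1)] show ?thesis unfolding F lin end_eq .
    qed
    have R: "0 \<le> ?R" by (rule integral_square_remainder_nonneg) (rule Ypos)
    note fo = first_order[OF ae]
    have "a = \<alpha> \<and> e = c" if "?R = 0"
    proof -
      have eq: "Y q = X q" if "q \<in> {0..1}" for q
        by (rule integral_square_remainder_eq_0[OF _ X exp(2) Xpos Ypos \<open>?R = 0\<close> that]) auto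
      \<comment> \<open>Tail integrals vanish at 1, so \<open>X 1\<close> and \<open>Y 1\<close> are
        the additive constants.\<close>
      have "(LBINT s:{1..1::real}. f s) = 0" for f :: "real \<Rightarrow> real"
        unfolding set_integral_half_open[symmetric, of 1 1] by (simp add: set_lebesgue_integral_def)
      then have ec: "e = c" using eq[of 1] by (simp add: X_def Y_def)
      have "a t - \<alpha> t = 0" if "t \<in> {0..<1}" for t
      proof (rule eq_0_if_upper_integrals_eq_0[OF d that])
        show "continuous (at_right t) (\<lambda>s. a s - \<alpha> s)"
          by (intro continuous_diff a(3) \<alpha>(3) that)
        show "(LBINT s:{q..1}. a s - \<alpha> s) = 0" if "q \<in> {0..1}" for q
          using Y[OF that] eq[OF that] ec by simp
      qed
      then show ?thesis using ec extensionalityI[OF a(4) \<alpha>(4)] by simp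
    qed
    moreover have "u \<le> v \<and> (u = v \<longrightarrow> r = 0)" if "2 * (v - u) = l + r" "0 \<le> l" "0 \<le> r" for u v l r :: real
      using that by auto
    from this[OF diff fo R] have "zero_temp_functional \<alpha> c \<nu> \<le> zero_temp_functional a e \<nu> \<and>
        (zero_temp_functional \<alpha> c \<nu> = zero_temp_functional a e \<nu> \<longrightarrow> ?R = 0)" .
    ultimately show ?thesis by blast
  qed
  show ?thesis
    unfolding zero_temp_minimizer_def
  proof (rule the_equality)
    show "is_arg_min (\<lambda>(\<alpha>, c). zero_temp_functional \<alpha> c \<nu>) (\<lambda>z. z \<in> zero_temp_domain) (\<alpha>, c)"
      using * dom by (auto simp: is_arg_min_linorder)
    fix z assume z: "is_arg_min (\<lambda>(\<alpha>, c). zero_temp_functional \<alpha> c \<nu>) (\<lambda>z. z \<in> zero_temp_domain) z"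
    obtain a e where ae: "z = (a, e)" by fastforce
    have "(a, e) \<in> zero_temp_domain" "zero_temp_functional a e \<nu> \<le> zero_temp_functional \<alpha> c \<nu>"
      using z dom unfolding ae is_arg_min_linorder by auto
    then show "z = (\<alpha>, c)" using *[of a e] unfolding ae by (metis antisym)
  qed
qed

text \<open>\<^term>\<open>\<alpha>\<close> may be unbounded near 1, so the second mean value theorem is applied to its truncations.\<close>

lemma set_integral_mult_mono_on_half_open_nonneg:
  fixes f \<alpha> :: "real \<Rightarrow> real"
  assumes f: "continuous_on {0..1} f"
    and pos: "\<And>s. s \<in> {0..1} \<Longrightarrow> 0 \<le> (LBINT t:{s..1}. f t)"
    and \<alpha>: "mono_on {0..<1} \<alpha>" "\<And>t. t \<in> {0..<1} \<Longrightarrow> 0 \<le> \<alpha> t" "set_integrable lborel {0..1} \<alpha>"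
  shows "0 \<le> (LBINT t:{0..1}. f t * \<alpha> t)"
proof -
  \<comment> \<open>The value \<open>real n\<close> at 1 bounds the truncation elsewhere, so
    \<open>a n\<close> is monotone on the closed interval whatever \<alpha> is at 1.\<close>
  define a where "a n t = (if t < 1 then min (\<alpha> t) (real n) else real n)" for n t
  have a_mono: "mono_on {0..1} (a n)" for n
    using mono_onD[OF \<alpha>(1)] by (fastforce simp: a_def mono_on_def min_le_iff_disj)
  have fi: "set_integrable lborel {0..1} f" by (intro borel_integrable_atLeastAtMost' f)
  have nonneg: "0 \<le> (LBINT t:{0..1}. f t * a n t)" for n
    using \<alpha>(2)[of 0] by (intro set_integral_mult_mono_on_nonneg fi pos a_mono) (auto simp: a_def)
  have prod: "set_integrable lborel {0..1} (\<lambda>t. f t * \<alpha> t)"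
    using set_integrable_mult_continuous_on[OF \<alpha>(3) f] by (simp add: mult.commute)
  have ai: "set_integrable lborel {0..1} (\<lambda>t. f t * a n t)" for n
    using set_integrable_mult_continuous_on[OF set_integrable_mono_on[OF a_mono] f] by (simp add: mult.commute)
  have "(\<lambda>n. LBINT t:{0..1}. f t * a n t) \<longlonglongrightarrow> (LBINT t:{0..1}. f t * \<alpha> t)"
    unfolding set_lebesgue_integral_def
  proof (rule integral_dominated_convergence[where w="\<lambda>t. \<bar>indicator {0..1} t *\<^sub>R (f t * \<alpha> t)\<bar>"])
    have ne1: "AE t in lborel. t \<noteq> (1::real)" by (rule AE_lborel_singleton)
    show "AE t in lborel. (\<lambda>n. indicat_real {0..1} t *\<^sub>R (f t * a n t)) \<longlonglongrightarrow> indicat_real {0..1} t *\<^sub>R (f t * \<alpha> t)"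
      using ne1
    proof eventually_elim
      case (elim t)
      have "eventually (\<lambda>n. a n t = \<alpha> t) sequentially" if "t \<in> {0..<1}"
      proof -
        obtain N where "\<alpha> t \<le> real N" using real_arch_simple by blast
        then show ?thesis using that
          by (intro eventually_sequentiallyI[of N]) (auto simp: a_def min_def)
      qed
      then have "(\<lambda>n. a n t) \<longlonglongrightarrow> \<alpha> t" if "t \<in> {0..<1}"
        using that by (auto intro: tendsto_eventually)
      then show ?case using elim by (cases "t \<in> {0..<1}") (auto intro!: tendsto_intros simp: indicator_def)
    qed
    show "AE t in lborel. norm (indicat_real {0..1} t *\<^sub>R (f t * a n t)) \<le> \<bar>indicat_real {0..1} t *\<^sub>R (f t * \<alpha> t)\<bar>" for n
      using ne1
    proof eventually_elim
      case (elim t)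
      have "\<bar>a n t\<bar> \<le> \<bar>\<alpha> t\<bar>" if "t \<in> {0..<1}" using \<alpha>(2)[OF that] that by (auto simp: a_def)
      then show ?case using elim by (auto simp: indicator_def abs_mult intro!: mult_left_mono)
    qed
    show "integrable lborel (\<lambda>t. \<bar>indicat_real {0..1} t *\<^sub>R (f t * \<alpha> t)\<bar>)"
      using prod unfolding set_integrable_def by (rule integrable_abs)
    show "(\<lambda>t. indicat_real {0..1} t *\<^sub>R (f t * \<alpha> t)) \<in> borel_measurable lborel"
      using prod unfolding set_integrable_def by (rule borel_measurable_integrable)
    show "(\<lambda>t. indicat_real {0..1} t *\<^sub>R (f t * a n t)) \<in> borel_measurable lborel" for n
      using ai[of n] unfolding set_integrable_def by (rule borel_measurable_integrable)
  qed
  then show ?thesis using nonneg by (intro LIMSEQ_le_const) auto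
qed

lemma deriv_left_mixture:
  assumes \<nu>: "mixture \<nu>" and q: "q \<in> {0<..<1}" and t: "t \<in> {0..1}"
  shows "deriv (left_mixture \<nu> q) t = q * deriv \<nu> (q * t)"
    and "(deriv (left_mixture \<nu> q) has_real_derivative deriv (deriv (left_mixture \<nu> q)) t) (at t)"
    and "deriv (deriv (left_mixture \<nu> q)) t = q\<^sup>2 * deriv (deriv \<nu>) (q * t)"
proof -
  \<comment> \<open>These are the points that multiplication by \<open>q\<close> sends into (-1, 1).
    As q < 1 they form an open neighbourhood of [0, 1], so the formula for the first derivative may
    itself be differentiated at the ends.\<close>
  define U where "U = {- (1 / q)<..<1 / q}"
  have U: "q * s \<in> {-1..1}" if "s \<in> U" for s
    using that q by (auto simp: U_def field_simps)
  have "1 < 1 / q" using q by simp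
  then have tU: "t \<in> U" using t by (auto simp: U_def)
  have D1: "deriv (left_mixture \<nu> q) s = q * deriv \<nu> (q * s)" if "s \<in> U" for s
  proof (rule DERIV_imp_deriv)
    have "((\<lambda>s. \<nu> (q * s)) has_real_derivative deriv \<nu> (q * s) * q) (at s)"
      by (rule DERIV_chain2[where f=\<nu> and g="\<lambda>s. q * s", OF mixture_derivs(1)[OF \<nu> U[OF that]]]) (auto intro!: derivative_eq_intros)
    then show "(left_mixture \<nu> q has_real_derivative q * deriv \<nu> (q * s)) (at s)"
      by (simp add: left_mixture_def[abs_def] mult.commute)
  qed
  show "deriv (left_mixture \<nu> q) t = q * deriv \<nu> (q * t)" by (rule D1[OF tU])
  have "((\<lambda>s. deriv \<nu> (q * s)) has_real_derivative deriv (deriv \<nu>) (q * t) * q) (at t)"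
    by (rule DERIV_chain2[where f="deriv \<nu>" and g="\<lambda>s. q * s", OF mixture_derivs(2)[OF \<nu> U[OF tU]]]) (auto intro!: derivative_eq_intros)
  then have "((\<lambda>s. q * deriv \<nu> (q * s)) has_real_derivative q\<^sup>2 * deriv (deriv \<nu>) (q * t)) (at t)"
    by (auto intro!: derivative_eq_intros simp: power2_eq_square)
  then have D2: "(deriv (left_mixture \<nu> q) has_real_derivative q\<^sup>2 * deriv (deriv \<nu>) (q * t)) (at t)"
    by (rule has_field_derivative_transform_within_open[OF _ _ tU]) (auto simp: D1 U_def)
  then show D3: "deriv (deriv (left_mixture \<nu> q)) t = q\<^sup>2 * deriv (deriv \<nu>) (q * t)"
    by (rule DERIV_imp_deriv)
  show "(deriv (left_mixture \<nu> q) has_real_derivative deriv (deriv (left_mixture \<nu> q)) t) (at t)"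
    using D2 D3 by simp
qed

context parisi
begin

text \<open>Scaling turns the tail plus constant into
  \<open>\<beta> / q * tail_mass x\<^sub>\<beta> (q * t)\<close> and the first variation into
  \<open>q / \<beta>\<^sup>2 * \<Phi> (q * t)\<close>. The latter vanishes at 1 by
  \<open>\<Phi> q = 0\<close>, integrates to a nonnegative value against every competitor, and to 0
  against the candidate.\<close>

lemma zero_temp_minimizer_left_mixture:
  assumes q: "q \<in> parisi_S \<beta> \<nu>" and q0: "0 < q"
  shows "zero_temp_minimizer (left_mixture \<nu> q) =
    (\<lambda>t\<in>{0..<1}. \<beta> * x\<^sub>\<beta> (q * t), \<beta> / q * tail_mass x\<^sub>\<beta> q)"
proof (rule zero_temp_minimizer_eqI[where \<Psi>="\<lambda>t. q / \<beta>\<^sup>2 * \<Phi> (q * t)"])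
  note q1 = S_less_1[OF q]
  have q01: "q \<in> {0<..<1}" using q0 q1 by simp
  define \<alpha> where "\<alpha> = (\<lambda>t\<in>{0..<1}. \<beta> * x\<^sub>\<beta> (q * t))"
  define X where "X t = (LBINT s:{t..1}. \<alpha> s) + \<beta> / q * tail_mass x\<^sub>\<beta> q" for t
  have qt: "0 \<le> q * t" "q * t \<le> q" "q * t \<le> 1" if "t \<in> {0..1}" for t
  proof -
    show "0 \<le> q * t" using that q0 by simp
    show "q * t \<le> q" using that q0 mult_left_le[of t q] by simp
    then show "q * t \<le> 1" using q1 by simp
  qed
  \<comment> \<open>The candidate has its formula only on [0, 1), hence the half-open interval. The
    free factor \<open>f\<close> covers both the tail integrals and the pairing with \<Phi>.\<close>
  have \<alpha>_integral: "(LBINT s:{t..1}. f s * \<alpha> s) = (LBINT s:{t..1}. f s * (\<beta> * x\<^sub>\<beta> (q * s)))" if "t \<in> {0..1}" for t f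
    unfolding set_integral_half_open[symmetric] using that
    by (intro set_lebesgue_integral_cong) (auto simp: \<alpha>_def)
  have scale: "(LBINT s:{q * a..q * b}. f s) = q * (LBINT s:{a..b}. f (q * s))" for a b and f :: "real \<Rightarrow> real"
    using set_integral_affine[OF q0, of 0 a b f] by simp
  have X_eq: "X t = \<beta> / q * tail_mass x\<^sub>\<beta> (q * t)" if t: "t \<in> {0..1}" for t
  proof -
    have "(LBINT s:{t..1}. \<alpha> s) = \<beta> * (LBINT s:{t..1}. x\<^sub>\<beta> (q * s))"
      using \<alpha>_integral[OF t, of "\<lambda>_. 1"] by simp
    also have "(LBINT s:{t..1}. x\<^sub>\<beta> (q * s)) = 1 / q * (LBINT s:{q * t..q}. x\<^sub>\<beta> s)"
      using scale[of t 1 x\<^sub>\<beta>] q0 by simp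
    finally show ?thesis
      unfolding X_def using tail_mass_split[OF x_in_domain, of "q * t" q] qt[OF t] q1
      by (simp add: distrib_left)
  qed
  have \<Psi>: "first_variation (deriv (left_mixture \<nu> q)) X t = q / \<beta>\<^sup>2 * \<Phi> (q * t)" if t: "t \<in> {0..1}" for t
  proof -
    have "(LBINT s:{0..t}. 1 / (X s)\<^sup>2) = (LBINT s:{0..t}. q\<^sup>2 / \<beta>\<^sup>2 * (1 / (tail_mass x\<^sub>\<beta> (q * s))\<^sup>2))"
      using t by (intro set_lebesgue_integral_cong) (auto simp: X_eq power_mult_distrib power_divide)
    also have "\<dots> = q\<^sup>2 / \<beta>\<^sup>2 * (LBINT s:{0..t}. 1 / (tail_mass x\<^sub>\<beta> (q * s))\<^sup>2)"
      by (rule set_integral_mult_right)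
    also have "\<dots> = q / \<beta>\<^sup>2 * (LBINT s:{0..q * t}. 1 / (tail_mass x\<^sub>\<beta> s)\<^sup>2)"
      using scale[of 0 t "\<lambda>s. 1 / (tail_mass x\<^sub>\<beta> s)\<^sup>2"] by (simp add: power2_eq_square)
    finally show ?thesis
      using deriv_left_mixture(1)[OF mixture q01 t] beta_pos
      unfolding Phi_eq_variation first_variation_def by (simp add: right_diff_distrib)
  qed
  have \<Psi>c: "continuous_on {0..1} (\<lambda>t. q / \<beta>\<^sup>2 * \<Phi> (q * t))"
    using qt q1 by (intro continuous_intros continuous_on_compose2[OF continuous_on_Phi[of q]]) auto
  have \<alpha>_mono: "mono_on {0..<1} \<alpha>"
  proof (rule mono_onI)
    fix s t :: real assume "s \<in> {0..<1}" "t \<in> {0..<1}" "s \<le> t"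
    then show "\<alpha> s \<le> \<alpha> t"
      using mono_onD[OF parisi_domainD(1)[OF x_in_domain], of "q * s" "q * t"] qt[of s] qt[of t] q0 beta_pos
      by (auto simp: \<alpha>_def)
  qed
  have \<alpha>_nonneg: "0 \<le> \<alpha> t" if "t \<in> {0..<1}" for t
    using parisi_domainD(2)[OF x_in_domain, of "q * t"] qt[of t] that beta_pos by (auto simp: \<alpha>_def)
  have x_scaled: "set_integrable lborel {0..1} (\<lambda>s. x\<^sub>\<beta> (q * s))"
    using set_integrable_affine[OF q0, of 0 0 1 x\<^sub>\<beta>] set_integrable_parisi_domain[OF x_in_domain, of 0 q] q1 by simp
  have \<alpha>_int: "set_integrable lborel {0..1} \<alpha>"
    unfolding set_integrable_half_open[symmetric]
  proof (rule set_integrable_cong[THEN iffD1])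
    show "set_integrable lborel {0..<1} (\<lambda>s. \<beta> * x\<^sub>\<beta> (q * s))"
      using x_scaled unfolding set_integrable_half_open by simp
  qed (auto simp: \<alpha>_def)
  show "(\<lambda>t\<in>{0..<1}. \<beta> * x\<^sub>\<beta> (q * t), \<beta> / q * tail_mass x\<^sub>\<beta> q) \<in> zero_temp_domain"
  proof -
    have "continuous (at_right t) \<alpha>" if t: "t \<in> {0..<1}" for t
    proof (rule continuous_at_right_cong[where b=1])
      show "continuous (at_right t) (\<lambda>t. \<beta> * x\<^sub>\<beta> (0 + q * t))"
        using t qt[of t] q1
        by (intro continuous_mult[OF continuous_const continuous_at_right_affine[OF q0, where f=x\<^sub>\<beta>]]
            parisi_domainD(4)[OF x_in_domain]) auto
    qed (use t in \<open>auto simp: \<alpha>_def\<close>)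
    moreover have "\<alpha> \<in> extensional {0..<1}" by (simp add: \<alpha>_def)
    moreover have "0 < \<beta> / q * tail_mass x\<^sub>\<beta> q"
      using beta_pos q0 q1 tail_mass_pos[OF x_in_domain, of q] by auto
    ultimately show ?thesis
      using \<alpha>_mono \<alpha>_nonneg \<alpha>_int unfolding \<alpha>_def[symmetric]
      by (auto simp: zero_temp_domain_def PiE_def set_integrable_half_open)
  qed
  show "first_variation (deriv (left_mixture \<nu> q))
      (\<lambda>t. (LBINT s:{t..1}. (\<lambda>t\<in>{0..<1}. \<beta> * x\<^sub>\<beta> (q * t)) s) + \<beta> / q * tail_mass x\<^sub>\<beta> q) t
      = q / \<beta>\<^sup>2 * \<Phi> (q * t)" if "t \<in> {0..1}" for t
    using \<Psi>[OF that] unfolding X_def \<alpha>_def .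
  show "q / \<beta>\<^sup>2 * \<Phi> (q * 1) = 0" using S_Phi_eq_0[OF q] by simp
  show "(deriv (left_mixture \<nu> q) has_real_derivative deriv (deriv (left_mixture \<nu> q)) t) (at t)"
    if "t \<in> {0..1}" for t
    by (rule deriv_left_mixture(2)[OF mixture q01 that])
  have "continuous_on {0..1} (\<lambda>t. q\<^sup>2 * deriv (deriv \<nu>) (q * t))"
    using qt by (intro continuous_intros continuous_on_compose2[OF mixture_continuous_on_deriv(2)[OF mixture]]) auto
  then show "continuous_on {0..1} (deriv (deriv (left_mixture \<nu> q)))"
    using deriv_left_mixture(3)[OF mixture q01] by (subst continuous_on_cong[OF refl])
  fix a e assume ae: "(a, e) \<in> zero_temp_domain"
  note a = zero_temp_domainD[OF ae]
  \<comment> \<open>Up to a positive factor these are the integrals of \<Phi> over [q s, q],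
    nonnegative by maximality of \<open>q\<close>.\<close>
  have "0 \<le> (LBINT t:{s..1}. q / \<beta>\<^sup>2 * \<Phi> (q * t))" if s: "s \<in> {0..1}" for s
  proof -
    have "0 \<le> (LBINT t:{q * s..q * 1}. \<Phi> t)"
      using S_integral_nonneg[OF q, of "q * s"] qt[OF s] by simp
    then have "0 \<le> (LBINT t:{s..1}. \<Phi> (q * t))" unfolding scale using q0 by (simp add: zero_le_mult_iff)
    then show ?thesis unfolding set_integral_mult_right using q0 by simp
  qed
  then have "0 \<le> (LBINT t:{0..1}. q / \<beta>\<^sup>2 * \<Phi> (q * t) * a t)"
    by (intro set_integral_mult_mono_on_half_open_nonneg \<Psi>c a)
  moreover have "(LBINT t:{0..1}. q / \<beta>\<^sup>2 * \<Phi> (q * t) * \<alpha> t) = 0"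
  proof -
    have "(LBINT t:{0..1}. \<Phi> (q * t) * x\<^sub>\<beta> (q * t)) = 0"
      using scale[of 0 1 "\<lambda>t. \<Phi> t * x\<^sub>\<beta> t"] integral_S_x_eq_0[OF q] q0 by simp
    moreover have "(LBINT t:{0..1}. q / \<beta>\<^sup>2 * \<Phi> (q * t) * \<alpha> t) =
        (LBINT t:{0..1}. q / \<beta> * (\<Phi> (q * t) * x\<^sub>\<beta> (q * t)))"
      using \<alpha>_integral[of 0 "\<lambda>t. q / \<beta>\<^sup>2 * \<Phi> (q * t)"] beta_pos
      by (simp add: power2_eq_square mult_ac)
    ultimately show ?thesis by (simp only: set_integral_mult_right mult_zero_right)
  qed
  moreover have "(LBINT t:{0..1}. q / \<beta>\<^sup>2 * \<Phi> (q * t) * (a t - \<alpha> t)) =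
      (LBINT t:{0..1}. q / \<beta>\<^sup>2 * \<Phi> (q * t) * a t) - (LBINT t:{0..1}. q / \<beta>\<^sup>2 * \<Phi> (q * t) * \<alpha> t)"
    unfolding right_diff_distrib
    using set_integrable_mult_continuous_on[OF a(5) \<Psi>c] set_integrable_mult_continuous_on[OF \<alpha>_int \<Psi>c]
    by (intro set_integral_diff) (simp_all add: mult.commute)
  ultimately show "0 \<le> (LBINT t:{0..1}. q / \<beta>\<^sup>2 * \<Phi> (q * t) * (a t - (\<lambda>t\<in>{0..<1}. \<beta> * x\<^sub>\<beta> (q * t)) t))"
    unfolding \<alpha>_def by linarith
qed

end

theorem proposition11:
  fixes \<nu> :: "real \<Rightarrow> real" and \<beta> q :: real
  assumes "mixture \<nu>" and "\<beta> > 0" and "q \<in> parisi_S \<beta> \<nu>"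
  shows "(\<forall>t\<in>{0..1}. parisi_distribution \<beta> (right_mixture \<nu> q) t
            = parisi_distribution \<beta> \<nu> (q + (1 - q) * t)) \<and>
         (q > 0 \<longrightarrow>
            (\<forall>t\<in>{0..<1}. fst (zero_temp_minimizer (left_mixture \<nu> q)) t
               = \<beta> * parisi_distribution \<beta> \<nu> (q * t)) \<and>
            snd (zero_temp_minimizer (left_mixture \<nu> q))
              = \<beta> / q * (LBINT s:{q..1}. parisi_distribution \<beta> \<nu> s))"
proof -
  interpret parisi \<nu> \<beta> using assms(1,2) by unfold_locales
  show ?thesis
    using parisi_distribution_right_mixture[OF assms(3)]
      zero_temp_minimizer_left_mixture[OF assms(3)]
    by (simp add: restrict_right_def tail_mass_def)
qed

end
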